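(* Let $\mu$ be a non-atomic probability distribution on $[0,1]$, let $r:[0,1]\to\mathbb{R}$ be a right-continuous function of bounded variation, and consider the model $Y=r(X)+\varepsilon$, where $X\sim\mu$ and $\varepsilon$ is a bounded random variable with $\mathbb{E}[\varepsilon\mid X]=0$. Let $\hat r_n^{(k)}$ denote the Iterative Isotonic Regression estimator after $k$ iterations, computed from an i.i.d. sample of size $n$ of $(X,Y)$ (see context). Then there exists an increasing sequence of integers $(k_n)$ such that $$\mathbb{E}\left[\|\hat r_n^{(k_n)}-r\|^2\right]\longrightarrow 0 \quad\text{as } n\to\infty,$$ where $\|g\|^2=\int_{[0,1]} g(x)^2\,\mu(dx)$ is the squared norm of $L_2(\mu)$ and the expectation is over the sample.
   Context: The sample $\mathcal{D}_n=\{(X_1,Y_1),\dots,(X_n,Y_n)\}$ consists of i.i.d. copies of $(X,Y)$. Let $x_1=X_{(1)}<\dots<x_n=X_{(n)}$ be the ordered sample and $y=(y_1,\dots,y_n)$ the corresponding responses. Let $\mathcal{C}_n^+=\{u\in\mathbb{R}^n: u_1\le\dots\le u_n\}$ and $\mathcal{C}_n^-=-\mathcal{C}_n^+$, and with $\|v\|_n^2=\frac1n\sum_{i=1}^n v_i^2$ define $\mathrm{iso}(z)=\arg\min_{u\in\mathcal{C}_n^+}\|z-u\|_n$ and $\mathrm{anti}(z)=\arg\min_{b\in\mathcal{C}_n^-}\|z-b\|_n$ (Euclidean projections onto these cones). The Iterative Isotonic Regression algorithm sets $\hat b_n^{(0)}=0\in\mathbb{R}^n$ and, for $k\ge1$,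 $\hat u_n^{(k)}=\mathrm{iso}(y-\hat b_n^{(k-1)})$, $\hat b_n^{(k)}=\mathrm{anti}(y-\hat u_n^{(k)})$, $\hat r_n^{(k)}=\hat u_n^{(k)}+\hat b_n^{(k)}$. A vector $v\in\mathbb{R}^n$ is identified with the right-continuous step function on $[0,1]$ given by $v(x)=v[1]$ for $x\in[0,X_{(2)})$, $v(x)=v[i]$ for $x\in[X_{(i)},X_{(i+1)})$, $2\le i\le n-1$, and $v(x)=v[n]$ for $x\in[X_{(n)},1]$; this is how $\hat r_n^{(k)}$ is viewed as a function in $L_2(\mu)$. *)

theory Defs
  imports "HOL-Probability.Probability"
begin

definition bounded_variation_on :: "(real \<Rightarrow> real) \<Rightarrow> real \<Rightarrow> real \<Rightarrow> bool" where
  "bounded_variation_on f a b \<longleftrightarrow>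
     (\<exists>B. \<forall>ts. sorted ts \<and> set ts \<subseteq> {a..b} \<longrightarrow>
        (\<Sum>i<length ts - 1. \<bar>f (ts ! Suc i) - f (ts ! i)\<bar>) \<le> B)"

definition right_continuous_on :: "(real \<Rightarrow> real) \<Rightarrow> real \<Rightarrow> real \<Rightarrow> bool" where
  "right_continuous_on f a b \<longleftrightarrow> (\<forall>x\<in>{a..<b}. continuous (at_right x) f)"

definition vminus :: "real list \<Rightarrow> real list \<Rightarrow> real list" where
  "vminus z u = map2 (-) z u"

definition vplus :: "real list \<Rightarrow> real list \<Rightarrow> real list" where
  "vplus z u = map2 (+) z u"

definition norm_n_sq :: "real list \<Rightarrow> real" where
  "norm_n_sq v = (\<Sum>x\<leftarrow>v. x\<^sup>2) / real (length v)"

definition cone_plus :: "nat \<Rightarrow> real list set" where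
  "cone_plus n = {u. length u = n \<and> sorted u}"

definition cone_minus :: "nat \<Rightarrow> real list set" where
  "cone_minus n = {b. length b = n \<and> (\<exists>u\<in>cone_plus n. b = map uminus u)}"

definition iso :: "real list \<Rightarrow> real list" where
  "iso z = (THE u. u \<in> cone_plus (length z) \<and>
              (\<forall>v\<in>cone_plus (length z). norm_n_sq (vminus z u) \<le> norm_n_sq (vminus z v)))"

definition anti :: "real list \<Rightarrow> real list" where
  "anti z = (THE b. b \<in> cone_minus (length z) \<and>
              (\<forall>v\<in>cone_minus (length z). norm_n_sq (vminus z b) \<le> norm_n_sq (vminus z v)))"

text \<open>iir_b y k = b^(k), with b^(0) = 0; iir_u y (Suc k) = u^(k+1); iir_r y k = r^(k) for k >= 1.\<close>
fun iir_b :: "real list \<Rightarrow> nat \<Rightarrow> real list" where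
  "iir_b y 0 = replicate (length y) 0"
| "iir_b y (Suc k) = anti (vminus y (iso (vminus y (iir_b y k))))"

definition iir_u :: "real list \<Rightarrow> nat \<Rightarrow> real list" where
  "iir_u y k = iso (vminus y (iir_b y (k - 1)))"

definition iir_r :: "real list \<Rightarrow> nat \<Rightarrow> real list" where
  "iir_r y k = vplus (iir_u y k) (iir_b y k)"

text \<open>Step function attached to a vector v and the ordered design points xs
  (0-indexed): v[0] on [0, xs!1), v[j] on [xs!j, xs!(j+1)), v[n-1] on [xs!(n-1), 1].\<close>
definition step_fun :: "real list \<Rightarrow> real list \<Rightarrow> real \<Rightarrow> real" where
  "step_fun xs v x = v ! length (filter (\<lambda>t. t \<le> x) (tl xs))"

definition ordered_sample :: "nat \<Rightarrow> (nat \<Rightarrow> real \<times> real) \<Rightarrow> (real \<times> real) list" where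
  "ordered_sample n \<omega> = sort_key fst (map \<omega> [0..<n])"

definition iir_estimator :: "nat \<Rightarrow> nat \<Rightarrow> (nat \<Rightarrow> real \<times> real) \<Rightarrow> real \<Rightarrow> real" where
  "iir_estimator n k \<omega> =
     step_fun (map fst (ordered_sample n \<omega>)) (iir_r (map snd (ordered_sample n \<omega>)) k)"

end

theory Submission
  imports Defs
begin

text \<open>
  Write \<open>r = p + q\<close> with \<open>p\<close> increasing and \<open>q\<close> decreasing, both bounded.  With \<open>a = y - b\<close> the algorithm is
  an instance of alternating projections between the cone of increasing vectors and the convex set
  \<open>y - cone_minus\<close>.  These sets contain \<open>p\<close> and \<open>y - q\<close> respectively, which differ by the noise
  \<open>\<epsilon>\<close>.  Fejer monotonicity towards this pair gives, for the empirical norm,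
  \<open>\<parallel>y - u_k - b_k\<parallel>\<^sup>2 - \<parallel>\<epsilon>\<parallel>\<^sup>2 \<le> \<parallel>q\<parallel>\<^sup>2 / (2 k) + noise\<close> and hence
  \<open>\<parallel>r - r_k\<parallel>\<^sup>2 \<le> \<parallel>q\<parallel>\<^sup>2 / (2 k) + noise\<close>, where the noise terms are inner products of \<open>\<epsilon>\<close> with sums of
  bounded monotone vectors.

  For fixed \<open>k\<close> these inner products and the difference between the empirical and the \<open>L\<^sub>2(\<mu>)\<close> norm are
  controlled by cutting the line into \<open>m\<close> intervals of \<open>\<mu>\<close>-mass at most \<open>1 / m\<close>: a monotone bounded function has
  bounded total oscillation over the intervals, and on each interval only the empirical frequency and the mean of the
  noise matter, which have fluctuations of order \<open>1 / sqrt n\<close>.  So the risk has limit superior at most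
  \<open>B\<^sup>2 / (2 k)\<close> for every \<open>k\<close>, and a diagonal choice of \<open>k_n\<close> finishes the proof.
\<close>

section \<open>Projections onto the monotone cones\<close>

text \<open>Every vector of length n is a sum of an increasing and a decreasing one, so the two
  convex sets always meet and iterating at fixed n drives the fit towards y itself. The comparison
  is therefore made with the pair given by r, whose gap is the noise, and k must be held fixed while
  n grows. The choices are nested: k comes first; then the number m of bins, large against constants
  that grow with k because the iterates are only bounded linearly in k; then n, large against m. The
  iterates depend on the noise, so the inner products have to be bounded uniformly over all bounded
  monotone vectors; the oscillation over bins gives such a bound from finitely many bin averages.
  Two further matters shape the proof. No sample is discarded, hence ties among the design points
  must be allowed for. And nothing makes r Borel outside the unit interval, so measurability of the
  loss and of the observations cannot be taken for granted.\<close>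

lemma cone_plus_iff: "u \<in> cone_plus n \<longleftrightarrow> length u = n \<and> mono_on {..<n} ((!) u)"
  by (auto simp: cone_plus_def sorted_iff_nth_mono mono_on_def)

lemma cone_minus_eq_image: "cone_minus n = map uminus ` cone_plus n"
proof
  show "cone_minus n \<subseteq> map uminus ` cone_plus n"
    unfolding cone_minus_def by blast
  show "map uminus ` cone_plus n \<subseteq> cone_minus n"
  proof
    fix b assume "b \<in> map uminus ` cone_plus n"
    then obtain u where "u \<in> cone_plus n" "b = map uminus u" by blast
    then show "b \<in> cone_minus n"
      unfolding cone_minus_def by (intro CollectI conjI bexI[of _ u]) (simp_all add: cone_plus_def)
  qed
qed

lemma norm_n_sq_vminus:
  assumes "length u = length z"
  shows "norm_n_sq (vminus z u) = (\<Sum>i<length z. (z!i - u!i)\<^sup>2) / real (length z)"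
  using assms by (simp add: norm_n_sq_def vminus_def sum_list_sum_nth atLeast0LessThan)

lemma norm_n_sq_vminus_le_iff:
  assumes "length u = length z" "length v = length z"
  shows "norm_n_sq (vminus z u) \<le> norm_n_sq (vminus z v) \<longleftrightarrow>
    (\<Sum>i<length z. (z!i - u!i)\<^sup>2) \<le> (\<Sum>i<length z. (z!i - v!i)\<^sup>2)"
  using assms by (cases "length z = 0") (auto simp: norm_n_sq_vminus divide_le_cancel)

text \<open>First-order optimality along the segment from \<open>u\<close> to \<open>v\<close>: at t
  = 0 the quadratic has derivative -2 times the sum. Only points of that segment are compared, so no
  convex set has to be named.\<close>

lemma minimizer_obtuse:
  fixes z u v :: "'i \<Rightarrow> real"
  assumes "\<And>t. 0 < t \<Longrightarrow> t \<le> 1 \<Longrightarrow>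
    (\<Sum>i\<in>A. (z i - u i)\<^sup>2) \<le> (\<Sum>i\<in>A. (z i - ((1 - t) * u i + t * v i))\<^sup>2)"
  shows "(\<Sum>i\<in>A. (z i - u i) * (v i - u i)) \<le> 0"
proof (rule ccontr)
  define s where "s = (\<Sum>i\<in>A. (z i - u i) * (v i - u i))"
  define N where "N = (\<Sum>i\<in>A. (v i - u i)\<^sup>2)"
  assume "\<not> ?thesis"
  then have s: "s > 0" by (simp add: s_def)
  have N: "N \<ge> 0" by (simp add: N_def sum_nonneg)
  have *: "2 * s \<le> t * N" if "0 < t" "t \<le> 1" for t
  proof -
    have "(\<Sum>i\<in>A. (z i - ((1 - t) * u i + t * v i))\<^sup>2)
        = (\<Sum>i\<in>A. (z i - u i)\<^sup>2 - (2 * t) * ((z i - u i) * (v i - u i)) + t\<^sup>2 * (v i - u i)\<^sup>2)"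
      by (intro sum.cong) (auto simp: power2_eq_square algebra_simps)
    also have "\<dots> = (\<Sum>i\<in>A. (z i - u i)\<^sup>2) - (2 * t) * s + t\<^sup>2 * N"
      by (simp add: sum.distrib sum_subtractf sum_distrib_left s_def N_def)
    finally have "t * (2 * s) \<le> t * (t * N)"
      using assms[OF that] by (simp add: power2_eq_square)
    then show ?thesis using that by simp
  qed
  \<comment> \<open>This \<open>t\<close> gives \<open>t * N \<le> s\<close>, against
    \<open>2 * s \<le> t * N\<close>; the 1 added to \<open>N\<close> covers
    \<open>N = 0\<close>.\<close>
  define t where "t = min 1 (s / (N + 1))"
  have "0 < t" "t \<le> 1" using s N by (auto simp: t_def)
  moreover have "t * N \<le> s"
  proof -
    have "t * N \<le> s / (N + 1) * N" using N by (intro mult_right_mono) (auto simp: t_def)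
    also have "\<dots> \<le> s" using s N by (simp add: field_simps)
    finally show ?thesis .
  qed
  ultimately show False using *[of t] s by auto
qed

text \<open>Clipping a competitor to the range of \<open>z\<close> keeps it monotone and moves no
  coordinate away from \<open>z\<close>, so the search may be confined to a compact box. The bound
  on the minimizer comes out of the same argument and later controls the growth of the
  iterates.\<close>

lemma ex_monotone_minimizer:
  fixes z :: "nat \<Rightarrow> real"
  assumes B: "\<And>i. i < n \<Longrightarrow> \<bar>z i\<bar> \<le> B"
  obtains u where "mono_on {..<n} u" "\<And>i. i < n \<Longrightarrow> \<bar>u i\<bar> \<le> B"
    "\<And>v. mono_on {..<n} v \<Longrightarrow> (\<Sum>i<n. (z i - u i)\<^sup>2) \<le> (\<Sum>i<n. (z i - v i)\<^sup>2)"
proof -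
  define B' where "B' = max B 0"
  have zB: "\<bar>z i\<bar> \<le> B'" if "i < n" for i using B[OF that] by (simp add: B'_def)
  \<comment> \<open>Vectors are functions on all of \<open>nat\<close> here; pinning the coordinates
    from \<open>n\<close> on to 0 makes the box a product of compact sets.\<close>
  define P where "P = Pi UNIV (\<lambda>i::nat. if i < n then {-B'..B'} else {0})"
  define K where "K = P \<inter> (\<Inter>i\<in>{..<n}. \<Inter>j\<in>{..<n}. {f. i \<le> j \<longrightarrow> f i \<le> f j})"
  have coord: "continuous_on UNIV (\<lambda>f::nat\<Rightarrow>real. f i)" for i
    using continuous_on_product_coordinates .
  have "compactin (product_topology (\<lambda>i. euclidean) UNIV) (PiE UNIV (\<lambda>i::nat. if i < n then {-B'..B'} else {0}))"
    by (subst compactin_PiE) auto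
  then have "compact P"
    by (simp add: P_def PiE_UNIV_domain flip: euclidean_product_topology compactin_euclidean_iff)
  moreover have "closed {f::nat\<Rightarrow>real. i \<le> j \<longrightarrow> f i \<le> f j}" for i j
    by (cases "i \<le> j") (auto intro!: closed_Collect_le coord)
  ultimately have "compact K"
    unfolding K_def by (intro compact_Int_closed closed_INT) auto
  moreover have "(\<lambda>_. 0) \<in> K" by (auto simp: K_def P_def B'_def)
  moreover have "continuous_on K (\<lambda>f. \<Sum>i<n. (z i - f i)\<^sup>2)"
    by (intro continuous_intros continuous_on_subset[OF coord]) auto
  ultimately obtain u where u: "u \<in> K" and
    min: "\<And>v. v \<in> K \<Longrightarrow> (\<Sum>i<n. (z i - u i)\<^sup>2) \<le> (\<Sum>i<n. (z i - v i)\<^sup>2)"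
    using continuous_attains_inf[of K "\<lambda>f. \<Sum>i<n. (z i - f i)\<^sup>2"] by blast
  show ?thesis
  proof
    show "mono_on {..<n} u" using u by (auto simp: K_def mono_on_def)
    show "\<bar>u i\<bar> \<le> B" if "i < n" for i
    proof -
      have "u i \<in> {-B'..B'}" using u that by (auto simp: K_def P_def Pi_iff split: if_splits dest!: spec[of _ i])
      moreover have "B \<ge> 0" using B[OF that] by linarith
      ultimately show ?thesis by (auto simp: B'_def)
    qed
  next
    fix v :: "nat \<Rightarrow> real" assume v: "mono_on {..<n} v"
    define w where "w i = (if i < n then max (-B') (min B' (v i)) else 0)" for i
    have "w \<in> K"
      unfolding K_def P_def
    proof (intro IntI Pi_I INT_I CollectI impI)
      show "w i \<in> (if i < n then {-B'..B'} else {0})" for i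
        by (auto simp: w_def B'_def)
      fix i j assume "i \<in> {..<n}" "j \<in> {..<n}" "i \<le> j"
      then have "i < n" "j < n" "v i \<le> v j" using v by (auto simp: mono_on_def)
      then show "w i \<le> w j" by (auto simp: w_def)
    qed
    then have "(\<Sum>i<n. (z i - u i)\<^sup>2) \<le> (\<Sum>i<n. (z i - w i)\<^sup>2)" by (rule min)
    also have "\<dots> \<le> (\<Sum>i<n. (z i - v i)\<^sup>2)"
    proof (rule sum_mono)
      fix i assume "i \<in> {..<n}"
      then have "\<bar>z i - w i\<bar> \<le> \<bar>z i - v i\<bar>" using zB[of i] by (auto simp: w_def)
      then show "(z i - w i)\<^sup>2 \<le> (z i - v i)\<^sup>2" by (simp add: abs_le_square_iff)
    qed
    finally show "(\<Sum>i<n. (z i - u i)\<^sup>2) \<le> (\<Sum>i<n. (z i - v i)\<^sup>2)" .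
  qed
qed

text \<open>Adding the variational inequalities of both minimizers, each tested at the other, leaves
  a squared distance of at most 0. The definite description in \<open>iso\<close> rests on
  this.\<close>

lemma iso_unique:
  assumes u: "u \<in> cone_plus (length z)"
    "\<And>v. v \<in> cone_plus (length z) \<Longrightarrow> norm_n_sq (vminus z u) \<le> norm_n_sq (vminus z v)"
  and w: "w \<in> cone_plus (length z)"
    "\<And>v. v \<in> cone_plus (length z) \<Longrightarrow> norm_n_sq (vminus z w) \<le> norm_n_sq (vminus z v)"
  shows "u = w"
proof -
  let ?n = "length z"
  have obtuse: "(\<Sum>i<?n. (z!i - u!i) * (v!i - u!i)) \<le> 0"
    if u: "u \<in> cone_plus ?n"
      "\<And>v. v \<in> cone_plus ?n \<Longrightarrow> norm_n_sq (vminus z u) \<le> norm_n_sq (vminus z v)"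
    and v: "v \<in> cone_plus ?n" for u v
  proof (rule minimizer_obtuse)
    fix t :: real assume t: "0 < t" "t \<le> 1"
    let ?w = "map (\<lambda>i. (1 - t) * u!i + t * v!i) [0..<?n]"
    have "?w \<in> cone_plus ?n"
      using u(1) v t unfolding cone_plus_iff mono_on_def by (auto intro!: add_mono mult_left_mono)
    then have "norm_n_sq (vminus z u) \<le> norm_n_sq (vminus z ?w)" by (rule u)
    then show "(\<Sum>i<?n. (z!i - u!i)\<^sup>2) \<le> (\<Sum>i<?n. (z!i - ((1 - t) * u!i + t * v!i))\<^sup>2)"
      using u(1) norm_n_sq_vminus_le_iff[of u z ?w] by (simp add: cone_plus_iff)
  qed
  have "(\<Sum>i<?n. (u!i - w!i)\<^sup>2) =
      (\<Sum>i<?n. (z!i - u!i) * (w!i - u!i)) + (\<Sum>i<?n. (z!i - w!i) * (u!i - w!i))"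
    unfolding sum.distrib[symmetric]
    by (intro sum.cong) (auto simp: power2_eq_square algebra_simps)
  also have "\<dots> \<le> 0" using obtuse[OF u w(1)] obtuse[OF w u(1)] by simp
  finally have "\<forall>i<?n. (u!i - w!i)\<^sup>2 = 0"
    using sum_nonneg_0[of "{..<?n}" "\<lambda>i. (u!i - w!i)\<^sup>2"]
      sum_nonneg[of "{..<?n}" "\<lambda>i. (u!i - w!i)\<^sup>2"] by (meson antisym finite_lessThan lessThan_iff zero_le_power2)
  then show ?thesis
    using u(1) w(1) by (auto intro!: nth_equalityI simp: cone_plus_iff)
qed


lemma iso_minimizer:
  shows iso_in_cone: "iso z \<in> cone_plus (length z)"
    and iso_le: "v \<in> cone_plus (length z) \<Longrightarrow> norm_n_sq (vminus z (iso z)) \<le> norm_n_sq (vminus z v)"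
    and iso_bounded: "(\<And>i. i < length z \<Longrightarrow> \<bar>z!i\<bar> \<le> B) \<Longrightarrow> i < length z \<Longrightarrow> \<bar>iso z ! i\<bar> \<le> B"
proof -
  let ?n = "length z"
  have ex: "\<exists>u. u \<in> cone_plus ?n \<and> (\<forall>i<?n. \<bar>u!i\<bar> \<le> B) \<and>
      (\<forall>v\<in>cone_plus ?n. norm_n_sq (vminus z u) \<le> norm_n_sq (vminus z v))"
    if B: "\<And>i. i < ?n \<Longrightarrow> \<bar>z!i\<bar> \<le> B" for B
  proof -
    obtain u where u: "mono_on {..<?n} u" "\<And>i. i < ?n \<Longrightarrow> \<bar>u i\<bar> \<le> B"
      "\<And>v. mono_on {..<?n} v \<Longrightarrow> (\<Sum>i<?n. (z!i - u i)\<^sup>2) \<le> (\<Sum>i<?n. (z!i - v i)\<^sup>2)"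
      using ex_monotone_minimizer[of ?n "(!) z" B, OF B] by blast
    have "map u [0..<?n] \<in> cone_plus ?n"
      using u(1) by (auto simp: cone_plus_iff mono_on_def)
    moreover have "norm_n_sq (vminus z (map u [0..<?n])) \<le> norm_n_sq (vminus z v)"
      if "v \<in> cone_plus ?n" for v
      using that u(3)[of "(!) v"] norm_n_sq_vminus_le_iff[of "map u [0..<?n]" z v]
      by (simp add: cone_plus_iff)
    ultimately show ?thesis using u(2) by (intro exI[of _ "map u [0..<?n]"]) auto
  qed
  have eq: "iso z = u" if "u \<in> cone_plus ?n"
      "\<And>v. v\<in>cone_plus ?n \<Longrightarrow> norm_n_sq (vminus z u) \<le> norm_n_sq (vminus z v)" for u
    unfolding iso_def using that by (intro the_equality) (auto intro: iso_unique)
  have "\<bar>z!i\<bar> \<le> Max (abs ` set z)" if "i < ?n" for i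
    using that by (intro Max_ge) auto
  from ex[OF this] obtain u where u: "u \<in> cone_plus ?n"
    "\<And>v. v\<in>cone_plus ?n \<Longrightarrow> norm_n_sq (vminus z u) \<le> norm_n_sq (vminus z v)"
    by blast
  then show "iso z \<in> cone_plus ?n"
    "v \<in> cone_plus ?n \<Longrightarrow> norm_n_sq (vminus z (iso z)) \<le> norm_n_sq (vminus z v)"
    using eq[OF u] by auto
  \<comment> \<open>Uniqueness identifies \<open>iso z\<close> with the minimizer found in the box
    of this particular size.\<close>
  show "\<bar>iso z ! i\<bar> \<le> B" if B: "\<And>i. i < ?n \<Longrightarrow> \<bar>z!i\<bar> \<le> B" and i: "i < ?n"
  proof -
    obtain u where u: "u \<in> cone_plus ?n" "\<forall>i<?n. \<bar>u!i\<bar> \<le> B"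
      "\<And>v. v\<in>cone_plus ?n \<Longrightarrow> norm_n_sq (vminus z u) \<le> norm_n_sq (vminus z v)"
      using ex[OF B] by blast
    show ?thesis using eq[OF u(1,3)] u(2) i by auto
  qed
qed

lemma iso_eqI:
  assumes "u \<in> cone_plus (length z)"
    "\<And>v. v \<in> cone_plus (length z) \<Longrightarrow> norm_n_sq (vminus z u) \<le> norm_n_sq (vminus z v)"
  shows "iso z = u"
  by (rule iso_unique[OF iso_in_cone iso_le assms])

lemma length_iso [simp]: "length (iso z) = length z"
  using iso_in_cone[of z] by (simp add: cone_plus_iff)

lemma iso_mono: "mono_on {..<length z} ((!) (iso z))"
  using iso_in_cone[of z] by (simp add: cone_plus_iff)

lemma iso_obtuse:
  assumes v: "mono_on {..<length z} v"
  shows "(\<Sum>i<length z. (z!i - iso z!i) * (v i - iso z!i)) \<le> 0"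
proof (rule minimizer_obtuse)
  let ?n = "length z"
  fix t :: real assume t: "0 < t" "t \<le> 1"
  let ?w = "map (\<lambda>i. (1 - t) * iso z!i + t * v i) [0..<?n]"
  have "?w \<in> cone_plus ?n"
    using iso_mono[of z] v t unfolding cone_plus_iff mono_on_def by (auto intro!: add_mono mult_left_mono)
  then have "norm_n_sq (vminus z (iso z)) \<le> norm_n_sq (vminus z ?w)" by (rule iso_le)
  then show "(\<Sum>i<?n. (z!i - iso z!i)\<^sup>2) \<le> (\<Sum>i<?n. (z!i - ((1 - t) * iso z!i + t * v i))\<^sup>2)"
    using norm_n_sq_vminus_le_iff[of "iso z" z ?w] by simp
qed

text \<open>The reflection at 0 is an isometry exchanging the two cones, so every property of
  \<open>anti\<close> is inherited from \<open>iso\<close>.\<close>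

lemma anti_eq_iso: "anti z = map uminus (iso (map uminus z))"
proof -
  have norm_neg: "norm_n_sq (vminus z (map uminus u)) = norm_n_sq (vminus (map uminus z) u)"
    if "length u = length z" for u
    using that by (simp add: norm_n_sq_vminus power2_eq_square algebra_simps)
  have cm: "v \<in> cone_minus (length z) \<longleftrightarrow> (\<exists>u\<in>cone_plus (length z). v = map uminus u)" for v
    unfolding cone_minus_eq_image by blast
  show ?thesis
    unfolding anti_def
  proof (rule the_equality)
    show "map uminus (iso (map uminus z)) \<in> cone_minus (length z) \<and>
      (\<forall>v\<in>cone_minus (length z). norm_n_sq (vminus z (map uminus (iso (map uminus z)))) \<le> norm_n_sq (vminus z v))"
    proof (intro conjI ballI)
      show "map uminus (iso (map uminus z)) \<in> cone_minus (length z)"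
        unfolding cone_minus_eq_image using iso_in_cone[of "map uminus z"] by simp
      fix v assume "v \<in> cone_minus (length z)"
      then obtain u where u: "u \<in> cone_plus (length z)" "v = map uminus u" unfolding cm by blast
      then show "norm_n_sq (vminus z (map uminus (iso (map uminus z)))) \<le> norm_n_sq (vminus z v)"
        using iso_le[of u "map uminus z"] iso_in_cone[of "map uminus z"]
        by (simp add: norm_neg cone_plus_def)
    qed
  next
    fix b assume b: "b \<in> cone_minus (length z) \<and>
      (\<forall>v\<in>cone_minus (length z). norm_n_sq (vminus z b) \<le> norm_n_sq (vminus z v))"
    then obtain u where u: "u \<in> cone_plus (length z)" "b = map uminus u" unfolding cm by blast
    have "iso (map uminus z) = u"
    proof (rule iso_eqI)
      fix v assume v: "v \<in> cone_plus (length (map uminus z))"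
      then have "norm_n_sq (vminus z b) \<le> norm_n_sq (vminus z (map uminus v))"
        using b v unfolding cone_minus_eq_image by simp
      then show "norm_n_sq (vminus (map uminus z) u) \<le> norm_n_sq (vminus (map uminus z) v)"
        using u v by (simp add: norm_neg cone_plus_def)
    qed (use u in simp)
    then show "b = map uminus (iso (map uminus z))" using u by simp
  qed
qed

lemma length_anti [simp]: "length (anti z) = length z"
  by (simp add: anti_eq_iso)

lemma anti_nth: "i < length z \<Longrightarrow> anti z ! i = - iso (map uminus z) ! i"
  by (simp add: anti_eq_iso)

lemma anti_mono: "mono_on {..<length z} (\<lambda>i. - anti z ! i)"
  using iso_mono[of "map uminus z"] by (simp add: anti_nth mono_on_def)

lemma anti_bounded:
  assumes "\<And>i. i < length z \<Longrightarrow> \<bar>z!i\<bar> \<le> B" "i < length z"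
  shows "\<bar>anti z ! i\<bar> \<le> B"
  using iso_bounded[of "map uminus z" B i] assms by (simp add: anti_nth)

lemma anti_obtuse:
  assumes v: "mono_on {..<length z} (\<lambda>i. - v i)"
  shows "(\<Sum>i<length z. (z!i - anti z!i) * (v i - anti z!i)) \<le> 0"
proof -
  have "(\<Sum>i<length z. (z!i - anti z!i) * (v i - anti z!i)) =
     (\<Sum>i<length (map uminus z). (map uminus z!i - iso (map uminus z)!i) * (- v i - iso (map uminus z)!i))"
    by (simp add: anti_nth algebra_simps)
  also have "\<dots> \<le> 0" using v by (intro iso_obtuse) simp
  finally show ?thesis .
qed

section \<open>Alternating projections\<close>

lemma vminus_nth [simp]: "i < length z \<Longrightarrow> i < length u \<Longrightarrow> vminus z u ! i = z!i - u!i"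
  by (simp add: vminus_def)

lemma length_vminus [simp]: "length (vminus z u) = min (length z) (length u)"
  by (simp add: vminus_def)

lemma vplus_nth [simp]: "i < length z \<Longrightarrow> i < length u \<Longrightarrow> vplus z u ! i = z!i + u!i"
  by (simp add: vplus_def)

lemma length_vplus [simp]: "length (vplus z u) = min (length z) (length u)"
  by (simp add: vplus_def)

lemma length_iir_b [simp]: "length (iir_b y k) = length y"
  by (induction k) auto

lemma length_iir_u [simp]: "length (iir_u y k) = length y"
  by (simp add: iir_u_def)

lemma length_iir_r [simp]: "length (iir_r y k) = length y"
  by (simp add: iir_r_def)

lemma iir_u_Suc: "iir_u y (Suc k) = iso (vminus y (iir_b y k))"
  by (simp add: iir_u_def)

lemma iir_b_Suc: "iir_b y (Suc k) = anti (vminus y (iir_u y (Suc k)))"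
  by (simp add: iir_u_def)

lemma iir_b_mono: "mono_on {..<length y} (\<lambda>i. - iir_b y k ! i)"
proof (cases k)
  case (Suc j)
  then show ?thesis using anti_mono[of "vminus y (iir_u y k)"] by (simp add: iir_b_Suc del: iir_b.simps)
qed (simp add: mono_on_def)

lemma iir_u_mono: "mono_on {..<length y} ((!) (iir_u y k))"
  using iso_mono[of "vminus y (iir_b y (k - 1))"] by (simp add: iir_u_def)

text \<open>A projection preserves any sup bound of its argument, and the argument is y minus the
  other iterate, so every half step adds at most one \<open>Y\<close>. Linear growth in k is good
  enough, since k is fixed before n grows.\<close>

lemma iir_bounded:
  assumes y: "\<And>i. i < length y \<Longrightarrow> \<bar>y!i\<bar> \<le> Y"
  shows iir_b_bounded: "i < length y \<Longrightarrow> \<bar>iir_b y k ! i\<bar> \<le> 2 * real k * Y"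
    and iir_u_bounded: "i < length y \<Longrightarrow> \<bar>iir_u y (Suc k) ! i\<bar> \<le> 2 * real (Suc k) * Y"
proof -
  have step: "\<bar>iir_u y (Suc k) ! i\<bar> \<le> (2 * real k + 1) * Y"
    if "\<And>i. i < length y \<Longrightarrow> \<bar>iir_b y k ! i\<bar> \<le> 2 * real k * Y" "i < length y" for k i
    unfolding iir_u_Suc
  proof (rule iso_bounded)
    fix i assume "i < length (vminus y (iir_b y k))"
    then show "\<bar>vminus y (iir_b y k) ! i\<bar> \<le> (2 * real k + 1) * Y"
      using y[of i] that(1)[of i] by (simp add: algebra_simps abs_le_iff)
  qed (use that in simp)
  show b: "\<bar>iir_b y k ! i\<bar> \<le> 2 * real k * Y" if "i < length y" for i k
    using that
  proof (induction k arbitrary: i)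
    case (Suc k)
    show ?case
      unfolding iir_b_Suc
    proof (rule anti_bounded)
      fix i assume i: "i < length (vminus y (iir_u y (Suc k)))"
      then have "\<bar>iir_u y (Suc k) ! i\<bar> \<le> (2 * real k + 1) * Y" using Suc.IH by (intro step) auto
      then show "\<bar>vminus y (iir_u y (Suc k)) ! i\<bar> \<le> 2 * real (Suc k) * Y"
        using y[of i] i by (simp add: algebra_simps abs_le_iff)
    qed (use Suc in simp)
  qed simp
  show "\<bar>iir_u y (Suc k) ! i\<bar> \<le> 2 * real (Suc k) * Y" if "i < length y"
    using step[OF b that, of k] y[OF that] by (simp add: algebra_simps)
qed

text \<open>The two hypotheses say that \<^term>\<open>u\<close> projects \<^term>\<open>y - b\<close> and \<^term>\<open>b'\<close> projects \<^term>\<open>y - u\<close>;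
  \<^term>\<open>p\<close> and \<^term>\<open>q\<close> are the points of comparison.\<close>

lemma alternating_projection_step:
  fixes y b u b' p q e :: "'i \<Rightarrow> real"
  assumes "(\<Sum>i\<in>A. (y i - b i - u i) * (p i - u i)) \<le> 0"
    and "(\<Sum>i\<in>A. (y i - u i - b' i) * (q i - b' i)) \<le> 0"
    and e: "\<And>i. i \<in> A \<Longrightarrow> e i = y i - p i - q i"
  shows "(\<Sum>i\<in>A. (b' i - q i)\<^sup>2) + (\<Sum>i\<in>A. (y i - u i - b i)\<^sup>2) + (\<Sum>i\<in>A. (y i - u i - b' i)\<^sup>2)
    \<le> (\<Sum>i\<in>A. (b i - q i)\<^sup>2) + 2 * (\<Sum>i\<in>A. e i * (p i + q i - u i - b i)) + 2 * (\<Sum>i\<in>A. (e i)\<^sup>2)"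
proof -
  have "(\<Sum>i\<in>A. (b i - q i)\<^sup>2) + 2 * (\<Sum>i\<in>A. e i * (p i + q i - u i - b i)) + 2 * (\<Sum>i\<in>A. (e i)\<^sup>2)
      - ((\<Sum>i\<in>A. (b' i - q i)\<^sup>2) + (\<Sum>i\<in>A. (y i - u i - b i)\<^sup>2) + (\<Sum>i\<in>A. (y i - u i - b' i)\<^sup>2))
    = (\<Sum>i\<in>A. (b i - q i)\<^sup>2 + 2 * (e i * (p i + q i - u i - b i)) + 2 * (e i)\<^sup>2
      - ((b' i - q i)\<^sup>2 + (y i - u i - b i)\<^sup>2 + (y i - u i - b' i)\<^sup>2))"
    by (simp add: sum.distrib sum_subtractf sum_distrib_left)
  \<comment> \<open>With \<open>e\<close> expanded, the gap between the two sides is coordinatewise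
    -2 times the two variational products.\<close>
  also have "\<dots> = (\<Sum>i\<in>A. - 2 * ((y i - b i - u i) * (p i - u i)) - 2 * ((y i - u i - b' i) * (q i - b' i)))"
    by (intro sum.cong refl, simp only: e) (simp add: power2_eq_square algebra_simps)
  also have "\<dots> = - 2 * (\<Sum>i\<in>A. (y i - b i - u i) * (p i - u i)) - 2 * (\<Sum>i\<in>A. (y i - u i - b' i) * (q i - b' i))"
    by (simp add: sum_subtractf sum_distrib_left)
  finally show ?thesis using assms(1,2) by linarith
qed

lemma obtuse_imp_closer:
  fixes z u v :: "'i \<Rightarrow> real"
  assumes "(\<Sum>i\<in>A. (z i - u i) * (v i - u i)) \<le> 0"
  shows "(\<Sum>i\<in>A. (z i - u i)\<^sup>2) \<le> (\<Sum>i\<in>A. (z i - v i)\<^sup>2)"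
proof -
  have "(\<Sum>i\<in>A. (z i - v i)\<^sup>2) = (\<Sum>i\<in>A. (z i - u i)\<^sup>2 - 2 * ((z i - u i) * (v i - u i)) + (v i - u i)\<^sup>2)"
    by (intro sum.cong) (auto simp: power2_eq_square algebra_simps)
  also have "\<dots> = (\<Sum>i\<in>A. (z i - u i)\<^sup>2) - 2 * (\<Sum>i\<in>A. (z i - u i) * (v i - u i)) + (\<Sum>i\<in>A. (v i - u i)\<^sup>2)"
    by (simp add: sum.distrib sum_subtractf sum_distrib_left)
  finally show ?thesis using assms sum_nonneg[of A "\<lambda>i. (v i - u i)\<^sup>2"] by auto
qed

text \<open>In each step the squared distance of b to q loses two squared residuals and gains only
  noise terms. The residuals decrease along the iteration, so k steps give the factor 1 / (2 k). The
  noise bound is required of all monotone pairs because the iterates depend on the noise; one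
  \<open>N\<close> comes from the averaged steps and two from expanding the last residual.\<close>

lemma iir_empirical_error:
  fixes y :: "real list" and p q :: "nat \<Rightarrow> real"
  defines "n \<equiv> length y" and "e \<equiv> \<lambda>i. y!i - p i - q i"
  assumes p: "mono_on {..<n} p" and q: "mono_on {..<n} (\<lambda>i. - q i)"
    and y: "\<And>i. i < n \<Longrightarrow> \<bar>y!i\<bar> \<le> Y"
    and k: "k \<ge> 1"
    and noise: "\<And>u b. mono_on {..<n} u \<Longrightarrow> mono_on {..<n} (\<lambda>i. - b i) \<Longrightarrow>
      (\<And>i. i < n \<Longrightarrow> \<bar>u i\<bar> \<le> 2 * real k * Y) \<Longrightarrow> (\<And>i. i < n \<Longrightarrow> \<bar>b i\<bar> \<le> 2 * real k * Y) \<Longrightarrow>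
      \<bar>\<Sum>i<n. e i * (p i + q i - u i - b i)\<bar> \<le> N"
  shows "(\<Sum>i<n. (p i + q i - iir_r y k ! i)\<^sup>2) \<le> (\<Sum>i<n. (q i)\<^sup>2) / (2 * real k) + 3 * N"
proof -
  let ?b = "\<lambda>k i. iir_b y k ! i" and ?u = "\<lambda>k i. iir_u y k ! i"
  define E where "E = (\<Sum>i<n. (e i)\<^sup>2)"
  define Q where "Q = (\<Sum>i<n. (q i)\<^sup>2)"
  define F where "F k = (\<Sum>i<n. (y!i - ?u k i - ?b k i)\<^sup>2)" for k
  have iso: "(\<Sum>i<n. (y!i - ?b j i - ?u (Suc j) i) * (v i - ?u (Suc j) i)) \<le> 0"
    if "mono_on {..<n} v" for v j
    using iso_obtuse[of "vminus y (iir_b y j)" v] that by (simp add: n_def iir_u_Suc)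
  have anti: "(\<Sum>i<n. (y!i - ?u (Suc j) i - ?b (Suc j) i) * (v i - ?b (Suc j) i)) \<le> 0"
    if "mono_on {..<n} (\<lambda>i. - v i)" for v j
    using anti_obtuse[of "vminus y (iir_u y (Suc j))" v] that by (simp add: n_def iir_b_Suc del: iir_b.simps)
  have G: "F (Suc j) \<le> (\<Sum>i<n. (y!i - ?u (Suc j) i - ?b j i)\<^sup>2)" for j
    unfolding F_def
    by (rule obtuse_imp_closer, rule anti) (simp add: n_def iir_b_mono)
  have F_decr: "F (Suc j) \<le> F j" if "j \<ge> 1" for j
  proof -
    have "(\<Sum>i<n. (y!i - ?b j i - ?u (Suc j) i)\<^sup>2) \<le> (\<Sum>i<n. (y!i - ?b j i - ?u j i)\<^sup>2)"
      by (rule obtuse_imp_closer, rule iso) (simp add: n_def iir_u_mono)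
    then have "(\<Sum>i<n. (y!i - ?u (Suc j) i - ?b j i)\<^sup>2) \<le> F j"
      by (simp add: F_def algebra_simps)
    with G[of j] show ?thesis by linarith
  qed
  have Y: "0 \<le> Y" if "n > 0" using y[OF that] by linarith
  have up: "2 * real j * Y \<le> 2 * real k * Y" if "j \<le> k" "i < n" for i j
    using that Y by (intro mult_right_mono) auto
  have noise_b: "\<bar>\<Sum>i<n. e i * (p i + q i - ?u (Suc j) i - ?b l i)\<bar> \<le> N" if "j < k" "l \<le> k" for j l
  proof (rule noise)
    show "\<bar>?u (Suc j) i\<bar> \<le> 2 * real k * Y" if "i < n" for i
      using iir_u_bounded[of y Y i j] y that up[of "Suc j" i] \<open>j < k\<close> by (force simp: n_def)
    show "\<bar>?b l i\<bar> \<le> 2 * real k * Y" if "i < n" for i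
      using iir_b_bounded[of y Y i l] y that up[of l i] \<open>l \<le> k\<close> by (force simp: n_def)
  qed (simp_all add: n_def iir_u_mono iir_b_mono)
  \<comment> \<open>The newest residual, with weight \<open>2 * real j\<close>, stands in for all
    earlier ones, which are at least as large. At j = 0 the start b = 0 makes the distance term
    equal to \<open>Q\<close>.\<close>
  have "(\<Sum>i<n. (?b j i - q i)\<^sup>2) + 2 * real j * F j \<le> Q + 2 * real j * (N + E)" if "j \<le> k" for j
    using that
  proof (induction j)
    case 0
    then show ?case by (simp add: Q_def n_def)
  next
    case (Suc j)
    have "(\<Sum>i<n. (?b (Suc j) i - q i)\<^sup>2) + (\<Sum>i<n. (y!i - ?u (Suc j) i - ?b j i)\<^sup>2) + F (Suc j)
       \<le> (\<Sum>i<n. (?b j i - q i)\<^sup>2) + 2 * (\<Sum>i<n. e i * (p i + q i - ?u (Suc j) i - ?b j i)) + 2 * E"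
      unfolding F_def E_def
      by (rule alternating_projection_step) (use iso[OF p] anti[OF q] in \<open>auto simp: e_def\<close>)
    moreover have "(\<Sum>i<n. e i * (p i + q i - ?u (Suc j) i - ?b j i)) \<le> N"
      using noise_b[of j j] Suc.prems by linarith
    moreover have "real j * F (Suc j) \<le> real j * F j"
      using F_decr[of j] by (cases "j = 0") (auto intro: mult_left_mono)
    ultimately show ?case using Suc G[of j] by (simp add: algebra_simps)
  qed
  from this[of k] have "2 * real k * F k \<le> Q + 2 * real k * (N + E)"
    using sum_nonneg[of "{..<n}" "\<lambda>i. (?b k i - q i)\<^sup>2"] by simp
  then have F: "F k \<le> Q / (2 * real k) + N + E"
    using k by (simp add: field_simps)
  \<comment> \<open>The residual y - u - b is \<open>e\<close> plus the error p + q - u - b, and its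
    square is expanded accordingly.\<close>
  have "(\<Sum>i<n. (p i + q i - iir_r y k ! i)\<^sup>2) =
      (\<Sum>i<n. (y!i - ?u k i - ?b k i)\<^sup>2 - (e i)\<^sup>2 - 2 * (e i * (p i + q i - ?u k i - ?b k i)))"
    by (intro sum.cong) (auto simp: e_def power2_eq_square iir_r_def n_def algebra_simps)
  also have "\<dots> = F k - E - 2 * (\<Sum>i<n. e i * (p i + q i - ?u k i - ?b k i))"
    by (simp add: sum_subtractf F_def E_def sum_distrib_left)
  also have "\<dots> \<le> Q / (2 * real k) + 3 * N"
    using F noise_b[of "k - 1" k] k by (simp add: abs_le_iff)
  finally show ?thesis by (simp add: Q_def)
qed

section \<open>Oscillation within bins\<close>

text \<open>Jumps between bins cost nothing; only the oscillation inside the bins is summed.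
  Witnesses \<open>d\<close> stand in for suprema, so empty bins need no convention.\<close>

definition bin_oscillation :: "'z set \<Rightarrow> nat \<Rightarrow> ('z \<Rightarrow> nat) \<Rightarrow> real \<Rightarrow> ('z \<Rightarrow> real) \<Rightarrow> bool" where
  "bin_oscillation S m \<beta> V w \<longleftrightarrow> (\<exists>d. (\<forall>j. 0 \<le> d j) \<and> (\<Sum>j<m. d j) \<le> V \<and>
     (\<forall>x\<in>S. \<forall>y\<in>S. \<beta> x = \<beta> y \<longrightarrow> \<bar>w x - w y\<bar> \<le> d (\<beta> x)))"

lemma bin_oscillationE:
  assumes "bin_oscillation S m \<beta> V w"
  obtains d where "\<And>j. 0 \<le> d j" "(\<Sum>j<m. d j) \<le> V"
    "\<And>x y. x \<in> S \<Longrightarrow> y \<in> S \<Longrightarrow> \<beta> x = \<beta> y \<Longrightarrow> \<bar>w x - w y\<bar> \<le> d (\<beta> x)"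
  using assms unfolding bin_oscillation_def by blast

text \<open>With \<open>L j\<close> the supremum of w over the bins before j, the values in bin j
  lie between \<open>L j\<close> and \<open>L (Suc j)\<close>, and the increments telescope.
  Monotonicity is asked only between different bins, which is what tolerates ties.\<close>

lemma bin_oscillation_mono:
  assumes mono: "\<And>x y. x \<in> S \<Longrightarrow> y \<in> S \<Longrightarrow> \<beta> x < \<beta> y \<Longrightarrow> w x \<le> w y"
    and B: "\<And>x. x \<in> S \<Longrightarrow> \<bar>w x\<bar> \<le> B" "0 \<le> B"
  shows "bin_oscillation S m \<beta> (2 * B) w"
proof -
  \<comment> \<open>Inserting \<open>- B\<close> gives the supremum a value when no point lies in an
    earlier bin.\<close>
  define L where "L j = Sup (insert (- B) (w ` {x\<in>S. \<beta> x < j}))" for j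
  have bdd: "bdd_above (insert (- B) (w ` {x\<in>S. \<beta> x < j}))" for j
    using B by (intro bdd_aboveI[of _ B]) (auto simp: abs_le_iff)
  have "L j \<le> B" for j
    unfolding L_def using B by (intro cSup_least) (auto simp: abs_le_iff)
  moreover have "- B \<le> L j" for j
    unfolding L_def by (intro cSup_upper bdd) auto
  moreover have "L j \<le> L (Suc j)" for j
    unfolding L_def by (intro cSup_subset_mono bdd) auto
  moreover have "L (\<beta> x) \<le> w x" if "x \<in> S" for x
    unfolding L_def using B(1)[OF that] mono that by (intro cSup_least) (auto simp: abs_le_iff)
  moreover have "w x \<le> L (Suc (\<beta> x))" if "x \<in> S" for x
    unfolding L_def using that by (intro cSup_upper bdd) auto
  ultimately have L: "L j \<le> B" "- B \<le> L j" "L j \<le> L (Suc j)"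
    "x \<in> S \<Longrightarrow> L (\<beta> x) \<le> w x \<and> w x \<le> L (Suc (\<beta> x))" for j x by blast+
  show ?thesis
    unfolding bin_oscillation_def
  proof (intro exI[of _ "\<lambda>j. L (Suc j) - L j"] conjI allI ballI impI)
    show "(\<Sum>j<m. L (Suc j) - L j) \<le> 2 * B"
      using L(1)[of m] L(2)[of 0] by (simp add: sum_lessThan_telescope)
    fix x y assume "x \<in> S" "y \<in> S" "\<beta> x = \<beta> y"
    then show "\<bar>w x - w y\<bar> \<le> L (Suc (\<beta> x)) - L (\<beta> x)"
      using L(4)[of x] L(4)[of y] by (simp add: abs_le_iff)
  qed (use L in simp)
qed

lemma bin_oscillation_minus:
  "bin_oscillation S m \<beta> V w \<Longrightarrow> bin_oscillation S m \<beta> V (\<lambda>x. - w x)"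
  unfolding bin_oscillation_def by (simp add: abs_minus_commute)

lemma bin_oscillation_antimono:
  assumes "\<And>x y. x \<in> S \<Longrightarrow> y \<in> S \<Longrightarrow> \<beta> x < \<beta> y \<Longrightarrow> w y \<le> w x"
    and "\<And>x. x \<in> S \<Longrightarrow> \<bar>w x\<bar> \<le> B" "0 \<le> B"
  shows "bin_oscillation S m \<beta> (2 * B) w"
  using bin_oscillation_minus[OF bin_oscillation_mono[of S \<beta> "\<lambda>x. - w x" B m]] assms by simp

lemma bin_oscillation_add:
  assumes "bin_oscillation S m \<beta> V w" "bin_oscillation S m \<beta> V' w'"
  shows "bin_oscillation S m \<beta> (V + V') (\<lambda>x. w x + w' x)"
proof -
  from assms(1) obtain d where d: "\<And>j. 0 \<le> d j" "(\<Sum>j<m. d j) \<le> V"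
      "\<And>x y. x \<in> S \<Longrightarrow> y \<in> S \<Longrightarrow> \<beta> x = \<beta> y \<Longrightarrow> \<bar>w x - w y\<bar> \<le> d (\<beta> x)"
    by (rule bin_oscillationE) (rule that)
  from assms(2) obtain d' where d': "\<And>j. 0 \<le> d' j" "(\<Sum>j<m. d' j) \<le> V'"
      "\<And>x y. x \<in> S \<Longrightarrow> y \<in> S \<Longrightarrow> \<beta> x = \<beta> y \<Longrightarrow> \<bar>w' x - w' y\<bar> \<le> d' (\<beta> x)"
    by (rule bin_oscillationE) (rule that)
  show ?thesis
    unfolding bin_oscillation_def
  proof (intro exI[of _ "\<lambda>j. d j + d' j"] conjI allI ballI impI)
    show "(\<Sum>j<m. d j + d' j) \<le> V + V'" using d(2) d'(2) by (simp add: sum.distrib)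
    fix x y assume "x \<in> S" "y \<in> S" "\<beta> x = \<beta> y"
    from d(3)[OF this] d'(3)[OF this]
    show "\<bar>w x + w' x - (w y + w' y)\<bar> \<le> d (\<beta> x) + d' (\<beta> x)" by linarith
  qed (use d d' in auto)
qed

lemma bin_oscillation_diff:
  assumes "bin_oscillation S m \<beta> V w" "bin_oscillation S m \<beta> V' w'"
  shows "bin_oscillation S m \<beta> (V + V') (\<lambda>x. w x - w' x)"
  using bin_oscillation_add[OF assms(1) bin_oscillation_minus[OF assms(2)]] by simp

lemma bin_oscillation_square:
  assumes "bin_oscillation S m \<beta> V w" and W: "\<And>x. x \<in> S \<Longrightarrow> \<bar>w x\<bar> \<le> W" "0 \<le> W"
  shows "bin_oscillation S m \<beta> (2 * W * V) (\<lambda>x. (w x)\<^sup>2)"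
proof -
  from assms(1) obtain d where d: "\<And>j. 0 \<le> d j" "(\<Sum>j<m. d j) \<le> V"
      "\<And>x y. x \<in> S \<Longrightarrow> y \<in> S \<Longrightarrow> \<beta> x = \<beta> y \<Longrightarrow> \<bar>w x - w y\<bar> \<le> d (\<beta> x)"
    by (rule bin_oscillationE) (rule that)
  show ?thesis
    unfolding bin_oscillation_def
  proof (intro exI[of _ "\<lambda>j. 2 * W * d j"] conjI allI ballI impI)
    show "(\<Sum>j<m. 2 * W * d j) \<le> 2 * W * V"
      using d(2) W by (simp add: mult_left_mono flip: sum_distrib_left)
    fix x y assume *: "x \<in> S" "y \<in> S" "\<beta> x = \<beta> y"
    have "\<bar>(w x)\<^sup>2 - (w y)\<^sup>2\<bar> = \<bar>w x + w y\<bar> * \<bar>w x - w y\<bar>"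
      by (simp add: power2_eq_square algebra_simps flip: abs_mult)
    also have "\<dots> \<le> (2 * W) * d (\<beta> x)"
      using W(1)[OF *(1)] W(1)[OF *(2)] d(3)[OF *] W(2) by (intro mult_mono) auto
    finally show "\<bar>(w x)\<^sup>2 - (w y)\<^sup>2\<bar> \<le> 2 * W * d (\<beta> x)" .
  qed (use d W in auto)
qed

lemma bin_oscillation_image:
  assumes "bin_oscillation S m \<beta> V w" "f ` T \<subseteq> S"
  shows "bin_oscillation T m (\<lambda>x. \<beta> (f x)) V (\<lambda>x. w (f x))"
proof -
  from assms(1) obtain d where d: "\<And>j. 0 \<le> d j" "(\<Sum>j<m. d j) \<le> V"
      "\<And>x y. x \<in> S \<Longrightarrow> y \<in> S \<Longrightarrow> \<beta> x = \<beta> y \<Longrightarrow> \<bar>w x - w y\<bar> \<le> d (\<beta> x)"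
    by (rule bin_oscillationE) (rule that)
  with assms(2) show ?thesis
    unfolding bin_oscillation_def by (intro exI[of _ d]) blast
qed

lemma sum_bins:
  fixes f :: "nat \<Rightarrow> real" and \<beta> :: "nat \<Rightarrow> nat"
  assumes "\<And>i. i < n \<Longrightarrow> \<beta> i < m"
  shows "(\<Sum>i<n. f i) = (\<Sum>j<m. \<Sum>i | i < n \<and> \<beta> i = j. f i)"
  using sum.group[of "{..<n}" "{..<m}" \<beta> f] assms by (simp add: image_subset_iff)

lemma bin_noise_bound:
  fixes e w :: "nat \<Rightarrow> real"
  assumes osc: "bin_oscillation {..<n} m \<beta> V w" and \<beta>: "\<And>i. i < n \<Longrightarrow> \<beta> i < m"
    and w: "\<And>i. i < n \<Longrightarrow> \<bar>w i\<bar> \<le> W" "0 \<le> W" and e: "\<And>i. i < n \<Longrightarrow> \<bar>e i\<bar> \<le> C" "0 \<le> C"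
    and c: "\<And>j. j < m \<Longrightarrow> real (card {i. i < n \<and> \<beta> i = j}) \<le> c" "0 \<le> c"
  shows "\<bar>\<Sum>i<n. e i * w i\<bar> \<le> W * (\<Sum>j<m. \<bar>\<Sum>i | i < n \<and> \<beta> i = j. e i\<bar>) + C * V * c"
proof -
  from osc obtain d where d: "\<And>j. 0 \<le> d j" "(\<Sum>j<m. d j) \<le> V"
      "\<And>x y. x \<in> {..<n} \<Longrightarrow> y \<in> {..<n} \<Longrightarrow> \<beta> x = \<beta> y \<Longrightarrow> \<bar>w x - w y\<bar> \<le> d (\<beta> x)"
    by (rule bin_oscillationE) (rule that)
  have bin: "\<bar>\<Sum>i | i < n \<and> \<beta> i = j. e i * w i\<bar> \<le> W * \<bar>\<Sum>i | i < n \<and> \<beta> i = j. e i\<bar> + C * c * d j"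
    if "j < m" for j
  proof (cases "{i. i < n \<and> \<beta> i = j} = {}")
    case False
    let ?I = "{i. i < n \<and> \<beta> i = j}"
    obtain l where l: "l < n" "\<beta> l = j" using False by auto
    have "(\<Sum>i\<in>?I. e i * w i) = w l * (\<Sum>i\<in>?I. e i) + (\<Sum>i\<in>?I. e i * (w i - w l))"
      by (simp add: sum_distrib_left right_diff_distrib sum_subtractf mult.commute[of "w l"])
    then have "\<bar>\<Sum>i\<in>?I. e i * w i\<bar> \<le> \<bar>w l\<bar> * \<bar>\<Sum>i\<in>?I. e i\<bar> + \<bar>\<Sum>i\<in>?I. e i * (w i - w l)\<bar>"
      using abs_triangle_ineq[of "w l * (\<Sum>i\<in>?I. e i)"] by (simp only: abs_mult)
    also have "\<dots> \<le> W * \<bar>\<Sum>i\<in>?I. e i\<bar> + C * c * d j"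
    proof (rule add_mono)
      have "\<bar>\<Sum>i\<in>?I. e i * (w i - w l)\<bar> \<le> (\<Sum>i\<in>?I. \<bar>e i * (w i - w l)\<bar>)" by (rule sum_abs)
      also have "\<dots> \<le> (\<Sum>i\<in>?I. C * d j)"
        using l d(3)[of _ l] e by (intro sum_mono) (auto simp: abs_mult intro!: mult_mono)
      also have "\<dots> = real (card ?I) * (C * d j)" by simp
      also have "\<dots> \<le> c * (C * d j)" using c(1)[OF that] e(2) d(1) by (intro mult_right_mono) auto
      finally show "\<bar>\<Sum>i\<in>?I. e i * (w i - w l)\<bar> \<le> C * c * d j" by (simp add: algebra_simps)
    qed (use w l in \<open>auto intro: mult_right_mono\<close>)
    finally show ?thesis .
  next
    case True
    show ?thesis unfolding True using e(2) c(2) d(1)[of j] by simp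
  qed
  have "\<bar>\<Sum>i<n. e i * w i\<bar> \<le> (\<Sum>j<m. \<bar>\<Sum>i | i < n \<and> \<beta> i = j. e i * w i\<bar>)"
    using sum_bins[of n \<beta> m "\<lambda>i. e i * w i"] \<beta> by (simp only: sum_abs)
  also have "\<dots> \<le> (\<Sum>j<m. W * \<bar>\<Sum>i | i < n \<and> \<beta> i = j. e i\<bar> + C * c * d j)"
    by (intro sum_mono bin) auto
  also have "\<dots> = W * (\<Sum>j<m. \<bar>\<Sum>i | i < n \<and> \<beta> i = j. e i\<bar>) + C * c * (\<Sum>j<m. d j)"
    by (simp add: sum.distrib sum_distrib_left)
  also have "C * c * (\<Sum>j<m. d j) \<le> C * c * V" using d(2) e(2) c(2) by (intro mult_left_mono) auto
  finally show ?thesis by (simp add: algebra_simps)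
qed

text \<open>Sample points (\<^term>\<open>Inl i\<close>) and points of the line (\<^term>\<open>Inr t\<close>) share one index type, so that the
  oscillation also compares values at the sample with values of the step function; this makes ties harmless.\<close>

lemma integral_le_bin_average:
  fixes h :: "nat + real \<Rightarrow> real" and x :: "nat \<Rightarrow> real"
  assumes "prob_space \<mu>" and [measurable_cong, simp]: "sets \<mu> = sets borel"
    and \<beta> [measurable]: "\<beta> \<in> borel \<rightarrow>\<^sub>M count_space UNIV" and \<beta>m: "\<And>t. \<beta> t < m"
    and h [measurable]: "(\<lambda>t. h (Inr t)) \<in> borel_measurable borel"
    and H: "\<And>z. z \<in> Inl ` {..<n} \<union> range Inr \<Longrightarrow> 0 \<le> h z \<and> h z \<le> H"
    and osc: "bin_oscillation (Inl ` {..<n} \<union> range Inr) m (case_sum (\<beta> \<circ> x) \<beta>) V h"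
    and n: "n > 0"
    and c: "\<And>j. j < m \<Longrightarrow> measure \<mu> {t. \<beta> t = j} + real (card {i. i < n \<and> \<beta> (x i) = j}) / n \<le> c" "0 \<le> c"
  shows "(\<integral>t. h (Inr t) \<partial>\<mu>) \<le> (\<Sum>i<n. h (Inl i)) / n
     + H * (\<Sum>j<m. \<bar>real (card {i. i < n \<and> \<beta> (x i) = j}) / n - measure \<mu> {t. \<beta> t = j}\<bar>) + V * c"
proof -
  interpret prob_space \<mu> by fact
  have [simp]: "space \<mu> = UNIV" using sets_eq_imp_space_eq[of \<mu> borel] by simp
  let ?S = "Inl ` {..<n} \<union> range Inr :: (nat + real) set"
  let ?A = "\<lambda>j. {t. \<beta> t = j}" and ?I = "\<lambda>j. {i. i < n \<and> \<beta> (x i) = j}"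
  from osc obtain d where d: "\<And>j. 0 \<le> d j" "(\<Sum>j<m. d j) \<le> V"
    and osc': "\<And>s t. s \<in> ?S \<Longrightarrow> t \<in> ?S \<Longrightarrow> case_sum (\<beta> \<circ> x) \<beta> s = case_sum (\<beta> \<circ> x) \<beta> t \<Longrightarrow>
      \<bar>h s - h t\<bar> \<le> d (case_sum (\<beta> \<circ> x) \<beta> s)"
    by (rule bin_oscillationE) (rule that)
  have H0: "0 \<le> H" using H[of "Inr 0"] by auto
  have [measurable]: "?A j \<in> sets borel" for j by measurable
  have int: "integrable \<mu> (\<lambda>t. h (Inr t))"
    using H by (intro integrable_const_bound[of _ H]) auto
  have bin: "(\<integral>t. indicator (?A j) t * h (Inr t) \<partial>\<mu>) \<le> (\<Sum>i\<in>?I j. h (Inl i)) / n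
     + H * \<bar>real (card (?I j)) / n - measure \<mu> (?A j)\<bar> + d j * c" if "j < m" for j
  proof (cases "?A j = {}")
    case True
    then have "?I j = {}" by auto
    with True show ?thesis using H0 d(1)[of j] c(2) by simp
  next
    case False
    then obtain s where s: "\<beta> s = j" by auto
    define a where "a = h (Inr s)"
    have a: "0 \<le> a" "a \<le> H" using H[of "Inr s"] by (auto simp: a_def)
    have "(\<integral>t. indicator (?A j) t * h (Inr t) \<partial>\<mu>) \<le> (\<integral>t. indicator (?A j) t * (a + d j) \<partial>\<mu>)"
    proof (rule integral_mono)
      show "integrable \<mu> (\<lambda>t. indicator (?A j) t * h (Inr t))"
        using H H0 by (intro integrable_const_bound[of _ H]) (auto simp: indicator_def)
      show "integrable \<mu> (\<lambda>t. indicator (?A j) t * (a + d j))"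
        by (intro integrable_const_bound[of _ "\<bar>a + d j\<bar>"]) (auto simp: indicator_def)
      fix t
      show "indicator (?A j) t * h (Inr t) \<le> indicator (?A j) t * (a + d j)"
        using osc'[of "Inr t" "Inr s"] s by (auto simp: indicator_def a_def abs_le_iff)
    qed
    also have "\<dots> = measure \<mu> (?A j) * (a + d j)" by simp
    finally have 1: "(\<integral>t. indicator (?A j) t * h (Inr t) \<partial>\<mu>) \<le> measure \<mu> (?A j) * (a + d j)" .
    have "real (card (?I j)) * (a - d j) \<le> (\<Sum>i\<in>?I j. h (Inl i))"
      using osc'[of "Inr s" "Inl _"] s
      by (intro sum_bounded_below) (force simp: a_def abs_le_iff algebra_simps)
    then have 2: "real (card (?I j)) / n * (a - d j) \<le> (\<Sum>i\<in>?I j. h (Inl i)) / n"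
      using n by (simp add: divide_right_mono)
    \<comment> \<open>The mismatch of masses is charged at the common value \<open>a\<close>. The
      oscillation \<open>d j\<close> is charged twice, on the line and on the sample, which is why
      \<open>c\<close> bounds the sum of the two masses.\<close>
    have "(measure \<mu> (?A j) - real (card (?I j)) / n) * a \<le> \<bar>real (card (?I j)) / n - measure \<mu> (?A j)\<bar> * H"
      using a by (intro mult_mono) auto
    moreover have "d j * (measure \<mu> (?A j) + real (card (?I j)) / n) \<le> d j * c"
      using c(1)[OF that] d(1) by (intro mult_left_mono)
    ultimately show ?thesis using 1 2 by (simp add: algebra_simps diff_divide_distrib)
  qed
  have "(\<integral>t. h (Inr t) \<partial>\<mu>) = (\<integral>t. (\<Sum>j<m. indicator (?A j) t * h (Inr t)) \<partial>\<mu>)"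
  proof (rule Bochner_Integration.integral_cong[OF refl])
    fix t
    have "(\<Sum>j<m. indicator (?A j) t * h (Inr t)) = (\<Sum>j<m. if j = \<beta> t then h (Inr t) else 0)"
      by (intro sum.cong) (auto simp: indicator_def)
    then show "h (Inr t) = (\<Sum>j<m. indicator (?A j) t * h (Inr t))" using \<beta>m[of t] by simp
  qed
  also have "\<dots> = (\<Sum>j<m. \<integral>t. indicator (?A j) t * h (Inr t) \<partial>\<mu>)"
    using H H0 by (intro Bochner_Integration.integral_sum integrable_const_bound[of _ H]) (auto simp: indicator_def)
  also have "\<dots> \<le> (\<Sum>j<m. (\<Sum>i\<in>?I j. h (Inl i)) / n
     + H * \<bar>real (card (?I j)) / n - measure \<mu> (?A j)\<bar> + d j * c)"
    by (intro sum_mono bin) auto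
  also have "\<dots> = (\<Sum>i<n. h (Inl i)) / n
     + H * (\<Sum>j<m. \<bar>real (card (?I j)) / n - measure \<mu> (?A j)\<bar>) + (\<Sum>j<m. d j) * c"
    by (simp add: sum_bins[of n "\<lambda>i. \<beta> (x i)" m "\<lambda>i. h (Inl i)"] \<beta>m sum.distrib sum_distrib_left sum_distrib_right sum_divide_distrib)
  also have "(\<Sum>j<m. d j) * c \<le> V * c" using d(2) c(2) by (rule mult_right_mono)
  finally show ?thesis by simp
qed

section \<open>The error on a fixed sample\<close>

lemma measurable_length_filter_le [measurable]:
  "(\<lambda>t::real. length (filter (\<lambda>s. s \<le> t) l)) \<in> borel \<rightarrow>\<^sub>M count_space UNIV"
proof (induction l)
  case (Cons a l)
  note Cons.IH [measurable]
  have "(\<lambda>t. if a \<le> t then Suc (length (filter (\<lambda>s. s \<le> t) l)) else length (filter (\<lambda>s. s \<le> t) l))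
      \<in> borel \<rightarrow>\<^sub>M count_space UNIV"
    by measurable
  then show ?case by (simp add: if_distrib cong: if_cong)
qed simp

text \<open>\<open>step_fun xs v t\<close> is \<open>v ! step_index xs t\<close>. Dropping the head
  of \<open>xs\<close> lets the first value extend to everything left of the second design
  point.\<close>

definition step_index :: "real list \<Rightarrow> real \<Rightarrow> nat" where
  "step_index xs t = length (filter (\<lambda>s. s \<le> t) (tl xs))"

lemma step_index_eq_card: "step_index xs t = card {i. Suc i < length xs \<and> xs ! Suc i \<le> t}"
proof -
  have "{i. i < length (tl xs) \<and> tl xs ! i \<le> t} = {i. Suc i < length xs \<and> xs ! Suc i \<le> t}"
    by (auto simp: nth_tl)
  then show ?thesis by (simp add: step_index_def length_filter_conv_card)
qed

lemma step_index_less: "xs \<noteq> [] \<Longrightarrow> step_index xs t < length xs"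
  using length_filter_le[of "\<lambda>s. s \<le> t" "tl xs"] by (cases xs) (auto simp: step_index_def less_Suc_eq_le)

lemma step_index_mono: "s \<le> t \<Longrightarrow> step_index xs s \<le> step_index xs t"
  unfolding step_index_eq_card by (intro card_mono) (auto intro: finite_subset[of _ "{..<length xs}"])

lemma step_index_le:
  assumes "sorted xs" "i < length xs" "t < xs ! i"
  shows "step_index xs t \<le> i"
proof -
  have "{j. Suc j < length xs \<and> xs ! Suc j \<le> t} \<subseteq> {..<i}"
  proof
    fix j assume j: "j \<in> {j. Suc j < length xs \<and> xs ! Suc j \<le> t}"
    then have "\<not> i \<le> Suc j" using assms sorted_nth_mono[of xs i "Suc j"] by auto
    then show "j \<in> {..<i}" by simp
  qed
  from card_mono[OF _ this] show ?thesis by (simp add: step_index_eq_card)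
qed

text \<open>Even at \<open>t = xs ! i\<close> equality may fail: the index of a repeated design
  point is that of its last copy.\<close>

lemma step_index_ge:
  assumes "sorted xs" "i < length xs" "xs ! i \<le> t"
  shows "i \<le> step_index xs t"
proof -
  have "{..<i} \<subseteq> {j. Suc j < length xs \<and> xs ! Suc j \<le> t}"
  proof
    fix j assume j: "j \<in> {..<i}"
    then show "j \<in> {j. Suc j < length xs \<and> xs ! Suc j \<le> t}"
      using assms sorted_nth_mono[of xs "Suc j" i] by auto
  qed
  moreover have "finite {j. Suc j < length xs \<and> xs ! Suc j \<le> t}"
    by (rule finite_subset[of _ "{..<length xs}"]) auto
  ultimately show ?thesis
    using card_mono[of "{j. Suc j < length xs \<and> xs ! Suc j \<le> t}" "{..<i}"] by (simp add: step_index_eq_card)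
qed

text \<open>All randomness of the sample enters the error bound through this number. It is invariant
  under a joint reordering of \<open>x\<close> and \<open>e\<close>, so sorting can be undone before
  taking expectations.\<close>

definition bin_discrepancy ::
    "real measure \<Rightarrow> (real \<Rightarrow> nat) \<Rightarrow> nat \<Rightarrow> nat \<Rightarrow> (nat \<Rightarrow> real) \<Rightarrow> (nat \<Rightarrow> real) \<Rightarrow> real" where
  "bin_discrepancy \<mu> \<beta> m n x e = (\<Sum>j<m.
     \<bar>real (card {i. i < n \<and> \<beta> (x i) = j}) / n - measure \<mu> {t. \<beta> t = j}\<bar>
     + \<bar>\<Sum>i | i < n \<and> \<beta> (x i) = j. e i\<bar> / n)"

text \<open>\<open>W\<close> bounds the error p + q - u - b, the iterates being at most
  \<open>2 * k * (2 * B + C)\<close>, and the oscillation of this error over the bins is at most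
  \<open>2 * W\<close>. The coefficients collect three times the noise bound
  \<open>W * Z + 2 * C * W * (\<delta> + Z)\<close> and, from the passage to \<open>\<mu>\<close>,
  the terms \<open>W^2 * Z + 4 * W^2 * (2 * \<delta> + Z)\<close>.\<close>

lemma iir_error_bound:
  fixes \<mu> :: "real measure" and p q :: "real \<Rightarrow> real" and xs ys :: "real list"
  assumes mu: "prob_space \<mu>" "sets \<mu> = sets borel"
    and \<beta>: "mono \<beta>" "\<And>t. \<beta> t < m" "\<beta> \<in> borel \<rightarrow>\<^sub>M count_space UNIV"
    and \<delta>: "\<And>j. measure \<mu> {t. \<beta> t = j} \<le> \<delta>"
    and p: "mono p" "\<And>t. \<bar>p t\<bar> \<le> B" and q: "antimono q" "\<And>t. \<bar>q t\<bar> \<le> B"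
    and xs: "sorted xs" "xs \<noteq> []" and len: "length ys = length xs" and k: "k \<ge> 1"
    and e: "\<And>i. i < length xs \<Longrightarrow> \<bar>ys!i - p (xs!i) - q (xs!i)\<bar> \<le> C"
  defines "W \<equiv> 2 * B + 4 * real k * (2 * B + C)"
    and "Z \<equiv> bin_discrepancy \<mu> \<beta> m (length xs) ((!) xs) (\<lambda>i. ys!i - p (xs!i) - q (xs!i))"
  shows "(\<integral>t. (step_fun xs (iir_r ys k) t - (p t + q t))\<^sup>2 \<partial>\<mu>)
     \<le> B\<^sup>2 / (2 * real k) + (3 * W + 6 * C * W + 8 * W\<^sup>2) * (\<delta> + Z)"
proof -
  define n where "n = length xs"
  have n: "n > 0" and lens: "length ys = n" "length xs = n" using xs len by (auto simp: n_def)
  define Y where "Y = 2 * B + C"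
  define R where "R = 2 * real k * Y"
  define E where "E i = ys!i - p (xs!i) - q (xs!i)" for i
  \<comment> \<open>Sample points and points of the line both get a location \<open>\<tau>\<close>
    and an index \<open>\<iota>\<close> at which the vectors are read. A sample point keeps its own
    index, which under ties can differ from the step index of its location.\<close>
  define \<tau> where "\<tau> = case_sum ((!) xs) (\<lambda>t. t)"
  define \<iota> where "\<iota> = case_sum (\<lambda>i. i) (step_index xs)"
  let ?S = "Inl ` {..<n} \<union> range Inr :: (nat + real) set"
  let ?I = "\<lambda>j. {i. i < n \<and> \<beta> (xs ! i) = j}"
  have B0: "0 \<le> B" using p(2)[of 0] by linarith
  have C0: "0 \<le> C" using e[of 0] n by (simp add: n_def)
  have Y0: "0 \<le> Y" using B0 C0 by (simp add: Y_def)
  have R0: "0 \<le> R" using Y0 by (simp add: R_def)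
  have W: "W = 2 * B + 2 * R" by (simp add: W_def R_def Y_def)
  have W0: "0 \<le> W" using B0 R0 by (simp add: W)
  have Z0: "0 \<le> Z" by (simp add: Z_def bin_discrepancy_def sum_nonneg)
  have \<delta>0: "0 \<le> \<delta>" using \<delta>[of 0] measure_nonneg[of \<mu> "{t. \<beta> t = 0}"] by linarith
  have \<beta>_less: "s < t" if "\<beta> s < \<beta> t" for s t
    using that monoD[OF \<beta>(1), of t s] by (meson linorder_not_less)
  have \<tau>_bin: "(case_sum (\<beta> \<circ> (!) xs) \<beta>) = (\<lambda>z. \<beta> (\<tau> z))"
    by (auto simp: \<tau>_def fun_eq_iff split: sum.split)
  have \<iota>_less: "\<iota> z < n" if "z \<in> ?S" for z
    using that step_index_less[OF xs(2)] by (auto simp: \<iota>_def lens)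
  \<comment> \<open>Different bins force different locations, so tied points never have to be
    compared.\<close>
  have \<iota>_mono: "\<iota> z \<le> \<iota> z'" if z: "z \<in> ?S" "z' \<in> ?S" and less: "\<beta> (\<tau> z) < \<beta> (\<tau> z')" for z z'
  proof -
    have *: "\<tau> z < \<tau> z'" using less by (rule \<beta>_less)
    consider i j where "z = Inl i" "z' = Inl j" "i < n" "j < n" | i t where "z = Inl i" "z' = Inr t" "i < n"
      | i t where "z = Inr t" "z' = Inl i" "i < n" | t t' where "z = Inr t" "z' = Inr t'"
      using z by blast
    then show ?thesis
    proof cases
      case 1
      then have "\<not> j \<le> i" using * sorted_nth_mono[OF xs(1), of j i] by (auto simp: \<tau>_def lens)
      with 1 show ?thesis by (simp add: \<iota>_def)
    next
      case 2
      with * step_index_ge[OF xs(1), of i t] show ?thesis by (simp add: \<iota>_def \<tau>_def lens)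
    next
      case 3
      with * step_index_le[OF xs(1), of i t] show ?thesis by (simp add: \<iota>_def \<tau>_def lens)
    next
      case 4
      with * step_index_mono[of t t' xs] show ?thesis by (simp add: \<iota>_def \<tau>_def)
    qed
  qed
  have osc_up: "bin_oscillation ?S m (\<lambda>z. \<beta> (\<tau> z)) (2 * R) (\<lambda>z. u (\<iota> z))"
    if "mono_on {..<n} u" "\<And>i. i < n \<Longrightarrow> \<bar>u i\<bar> \<le> R" for u
  proof (rule bin_oscillation_mono)
    fix z z' assume z: "z \<in> ?S" "z' \<in> ?S" "\<beta> (\<tau> z) < \<beta> (\<tau> z')"
    show "u (\<iota> z) \<le> u (\<iota> z')"
      by (rule mono_onD[OF that(1)]) (use \<iota>_less[OF z(1)] \<iota>_less[OF z(2)] \<iota>_mono[OF z] in auto)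
  next
    fix z assume "z \<in> ?S"
    show "\<bar>u (\<iota> z)\<bar> \<le> R" by (rule that(2), rule \<iota>_less) fact
  qed (rule R0)
  have osc_down: "bin_oscillation ?S m (\<lambda>z. \<beta> (\<tau> z)) (2 * R) (\<lambda>z. b (\<iota> z))"
    if "mono_on {..<n} (\<lambda>i. - b i)" "\<And>i. i < n \<Longrightarrow> \<bar>b i\<bar> \<le> R" for b
    using bin_oscillation_minus[OF osc_up[of "\<lambda>i. - b i"]] that by simp
  have osc_p: "bin_oscillation ?S m (\<lambda>z. \<beta> (\<tau> z)) (2 * B) (\<lambda>z. p (\<tau> z))"
    by (rule bin_oscillation_mono[OF monoD[OF p(1) less_imp_le[OF \<beta>_less]] p(2) B0])
  have osc_q: "bin_oscillation ?S m (\<lambda>z. \<beta> (\<tau> z)) (2 * B) (\<lambda>z. q (\<tau> z))"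
    by (rule bin_oscillation_antimono[OF antimonoD[OF q(1) less_imp_le[OF \<beta>_less]] q(2) B0])
  have osc: "bin_oscillation ?S m (\<lambda>z. \<beta> (\<tau> z)) (2 * W) (\<lambda>z. p (\<tau> z) + q (\<tau> z) - u (\<iota> z) - b (\<iota> z))"
    if "mono_on {..<n} u" "\<And>i. i < n \<Longrightarrow> \<bar>u i\<bar> \<le> R"
      "mono_on {..<n} (\<lambda>i. - b i)" "\<And>i. i < n \<Longrightarrow> \<bar>b i\<bar> \<le> R" for u b
    using bin_oscillation_diff[OF bin_oscillation_diff[OF bin_oscillation_add[OF osc_p osc_q]
      osc_up[OF that(1,2)]] osc_down[OF that(3,4)]]
    by (simp add: W algebra_simps)
  have bound: "\<bar>p s + q s - u i - b i\<bar> \<le> W" if "\<bar>u i\<bar> \<le> R" "\<bar>b i\<bar> \<le> R" for u b s and i :: nat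
    using p(2)[of s] q(2)[of s] that by (simp add: W abs_le_iff)
  have Z: "Z = (\<Sum>j<m. \<bar>real (card (?I j)) / n - measure \<mu> {t. \<beta> t = j}\<bar>) + (\<Sum>j<m. \<bar>\<Sum>i\<in>?I j. E i\<bar>) / n"
    by (simp add: Z_def bin_discrepancy_def E_def lens sum.distrib sum_divide_distrib)
  \<comment> \<open>One bin contributes one summand of \<open>Z\<close>, so its frequency exceeds
    its mass by at most \<open>Z\<close>.\<close>
  have card: "real (card (?I j)) / n \<le> \<delta> + Z" if "j < m" for j
  proof -
    have "\<bar>real (card (?I j)) / n - measure \<mu> {t. \<beta> t = j}\<bar> \<le>
        (\<Sum>j<m. \<bar>real (card (?I j)) / n - measure \<mu> {t. \<beta> t = j}\<bar>)"
      using that by (intro member_le_sum) auto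
    also have "\<dots> \<le> Z" by (simp add: Z sum_nonneg)
    finally show ?thesis using \<delta>[of j] by linarith
  qed
  define N where "N = real n * (W * Z + 2 * C * W * (\<delta> + Z))"
  have ys: "\<bar>ys!i\<bar> \<le> Y" if "i < n" for i
    using e[of i] p(2)[of "xs!i"] q(2)[of "xs!i"] that by (simp add: Y_def lens abs_le_iff)
  have "(\<Sum>i<length ys. (p (xs!i) + q (xs!i) - iir_r ys k ! i)\<^sup>2)
      \<le> (\<Sum>i<length ys. (q (xs!i))\<^sup>2) / (2 * real k) + 3 * N"
  proof (rule iir_empirical_error)
    show "mono_on {..<length ys} (\<lambda>i. p (xs ! i))"
      using monoD[OF p(1)] sorted_nth_mono[OF xs(1)] by (auto simp: mono_on_def lens)
    show "mono_on {..<length ys} (\<lambda>i. - q (xs ! i))"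
      using antimonoD[OF q(1)] sorted_nth_mono[OF xs(1)] by (auto simp: mono_on_def lens)
    show "\<bar>ys ! i\<bar> \<le> Y" if "i < length ys" for i using ys that by (simp add: lens)
    show "k \<ge> 1" by (rule k)
    fix u b assume "mono_on {..<length ys} u" "mono_on {..<length ys} (\<lambda>i. - b i)"
      "\<And>i. i < length ys \<Longrightarrow> \<bar>u i\<bar> \<le> 2 * real k * Y" "\<And>i. i < length ys \<Longrightarrow> \<bar>b i\<bar> \<le> 2 * real k * Y"
    then have ub: "mono_on {..<n} u" "\<And>i. i < n \<Longrightarrow> \<bar>u i\<bar> \<le> R"
      "mono_on {..<n} (\<lambda>i. - b i)" "\<And>i. i < n \<Longrightarrow> \<bar>b i\<bar> \<le> R" by (simp_all add: lens R_def)
    have "bin_oscillation {..<n} m (\<lambda>i. \<beta> (xs!i)) (2 * W) (\<lambda>i. p (xs!i) + q (xs!i) - u i - b i)"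
      using bin_oscillation_image[OF osc[OF ub], of Inl "{..<n}"] by (simp add: \<tau>_def \<iota>_def)
    then have "\<bar>\<Sum>i<n. E i * (p (xs!i) + q (xs!i) - u i - b i)\<bar>
       \<le> W * (\<Sum>j<m. \<bar>\<Sum>i\<in>?I j. E i\<bar>) + C * (2 * W) * (n * (\<delta> + Z))"
    proof (rule bin_noise_bound)
      show "real (card (?I j)) \<le> n * (\<delta> + Z)" if "j < m" for j
        using card[OF that] n by (simp add: field_simps)
    qed (use \<beta> bound ub e W0 C0 Z0 \<delta>0 in \<open>auto simp: E_def lens\<close>)
    also have "\<dots> \<le> W * (n * Z) + C * (2 * W) * (n * (\<delta> + Z))"
    proof -
      have "(\<Sum>j<m. \<bar>\<Sum>i\<in>?I j. E i\<bar>) / n \<le> Z" by (simp add: Z sum_nonneg)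
      then have "(\<Sum>j<m. \<bar>\<Sum>i\<in>?I j. E i\<bar>) \<le> n * Z" using n by (simp add: field_simps)
      then show ?thesis using W0 by (intro add_right_mono mult_left_mono)
    qed
    finally show "\<bar>\<Sum>i<length ys. (ys!i - p (xs!i) - q (xs!i)) * (p (xs!i) + q (xs!i) - u i - b i)\<bar> \<le> N"
      by (simp add: E_def lens N_def algebra_simps)
  qed
  also have "(\<Sum>i<length ys. (q (xs!i))\<^sup>2) \<le> n * B\<^sup>2"
  proof -
    have "(q t)\<^sup>2 \<le> B\<^sup>2" for t using q(2)[of t] B0 abs_le_square_iff[of "q t" B] by simp
    then show ?thesis
      using sum_bounded_above[of "{..<length ys}" "\<lambda>i. (q (xs!i))\<^sup>2" "B\<^sup>2"] by (simp add: lens)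
  qed
  finally have "(\<Sum>i<n. (p (xs!i) + q (xs!i) - iir_r ys k ! i)\<^sup>2) \<le> n * B\<^sup>2 / (2 * real k) + 3 * N"
    using k by (simp add: lens divide_right_mono)
  then have "(\<Sum>i<n. (p (xs!i) + q (xs!i) - iir_r ys k ! i)\<^sup>2) / n \<le> (n * B\<^sup>2 / (2 * real k) + 3 * N) / n"
    by (rule divide_right_mono) simp
  also have "\<dots> = B\<^sup>2 / (2 * real k) + 3 * (W * Z + 2 * C * W * (\<delta> + Z))"
    using n by (simp add: N_def add_divide_distrib)
  finally have emp: "(\<Sum>i<n. (p (xs!i) + q (xs!i) - iir_r ys k ! i)\<^sup>2) / n \<le> \<dots>" .
  let ?u = "\<lambda>i. iir_u ys k ! i" and ?b = "\<lambda>i. iir_b ys k ! i"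
  \<comment> \<open>On sample points this is the empirical squared error, on the line the integrand
    of the loss.\<close>
  define h where "h z = (p (\<tau> z) + q (\<tau> z) - ?u (\<iota> z) - ?b (\<iota> z))\<^sup>2" for z
  have u: "mono_on {..<n} ?u" "\<And>i. i < n \<Longrightarrow> \<bar>?u i\<bar> \<le> R"
    using iir_u_mono[of ys k] iir_u_bounded[of ys Y _ "k - 1"] ys k by (auto simp: lens R_def)
  have b: "mono_on {..<n} (\<lambda>i. - ?b i)" "\<And>i. i < n \<Longrightarrow> \<bar>?b i\<bar> \<le> R"
    using iir_b_mono[of ys k] iir_b_bounded[of ys Y _ k] ys by (auto simp: lens R_def)
  have h_le: "h z \<le> W\<^sup>2" if "z \<in> ?S" for z
    unfolding h_def using bound[of ?u "\<iota> z" ?b "\<tau> z"] u(2) b(2) \<iota>_less[OF that] W0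
    by (simp add: power2_le_iff_abs_le)
  have [measurable]: "p \<in> borel_measurable borel" "q \<in> borel_measurable borel"
    using p(1) q(1) borel_measurable_mono[of p] borel_measurable_mono[of "\<lambda>t. - q t"]
    by (auto simp: mono_def antimono_def)
  have [measurable]: "step_index xs \<in> borel \<rightarrow>\<^sub>M count_space UNIV"
    unfolding step_index_def by measurable
  have "(\<integral>t. h (Inr t) \<partial>\<mu>) \<le> (\<Sum>i<n. h (Inl i)) / n
     + W\<^sup>2 * (\<Sum>j<m. \<bar>real (card (?I j)) / n - measure \<mu> {t. \<beta> t = j}\<bar>) + 2 * W * (2 * W) * (2 * \<delta> + Z)"
  proof (rule integral_le_bin_average[OF mu \<beta>(3,2)])
    show "bin_oscillation ?S m (case_sum (\<beta> \<circ> (!) xs) \<beta>) (2 * W * (2 * W)) h"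
      unfolding \<tau>_bin h_def[abs_def]
      using osc[OF u b] bound u b \<iota>_less W0 by (intro bin_oscillation_square) auto
    show "(\<lambda>t. h (Inr t)) \<in> borel_measurable borel"
      unfolding h_def \<tau>_def \<iota>_def sum.case by measurable
    show "measure \<mu> {t. \<beta> t = j} + real (card (?I j)) / n \<le> 2 * \<delta> + Z" if "j < m" for j
      using \<delta>[of j] card[OF that] by linarith
    show "0 \<le> h z \<and> h z \<le> W\<^sup>2" if "z \<in> ?S" for z using h_le[OF that] by (simp add: h_def)
  qed (use n \<delta>0 Z0 in auto)
  also have "(\<integral>t. h (Inr t) \<partial>\<mu>) = (\<integral>t. (step_fun xs (iir_r ys k) t - (p t + q t))\<^sup>2 \<partial>\<mu>)"
  proof (rule Bochner_Integration.integral_cong[OF refl])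
    fix t
    have "step_index xs t < n" using step_index_less[OF xs(2)] by (simp add: lens)
    then have "step_fun xs (iir_r ys k) t = ?u (step_index xs t) + ?b (step_index xs t)"
      by (simp add: step_fun_def iir_r_def lens flip: step_index_def)
    then show "h (Inr t) = (step_fun xs (iir_r ys k) t - (p t + q t))\<^sup>2"
      by (simp add: h_def \<tau>_def \<iota>_def power2_eq_square algebra_simps)
  qed
  also have "(\<Sum>i<n. h (Inl i)) / n = (\<Sum>i<n. (p (xs!i) + q (xs!i) - iir_r ys k ! i)\<^sup>2) / n"
    by (simp add: h_def \<tau>_def \<iota>_def iir_r_def lens algebra_simps)
  also have "\<dots> \<le> B\<^sup>2 / (2 * real k) + 3 * (W * Z + 2 * C * W * (\<delta> + Z))" by (rule emp)
  also have "W\<^sup>2 * (\<Sum>j<m. \<bar>real (card (?I j)) / n - measure \<mu> {t. \<beta> t = j}\<bar>) \<le> W\<^sup>2 * Z"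
    by (intro mult_left_mono) (auto simp: Z sum_nonneg)
  finally have "(\<integral>t. (step_fun xs (iir_r ys k) t - (p t + q t))\<^sup>2 \<partial>\<mu>) \<le>
     B\<^sup>2 / (2 * real k) + 3 * (W * Z + 2 * C * W * (\<delta> + Z)) + W\<^sup>2 * Z + 2 * W * (2 * W) * (2 * \<delta> + Z)"
    by simp
  also have "\<dots> \<le> B\<^sup>2 / (2 * real k) + (3 * W + 6 * C * W + 8 * W\<^sup>2) * (\<delta> + Z)"
  proof -
    have "0 \<le> 3 * W * \<delta>" "0 \<le> W\<^sup>2 * Z" using W0 \<delta>0 Z0 by auto
    then show ?thesis by (simp add: algebra_simps power2_eq_square)
  qed
  finally show ?thesis .
qed

section \<open>Measurability\<close>

text \<open>The keys are random but the items are fixed, so the resulting list is a random element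
  of a discrete space.\<close>

lemma measurable_insort_key:
  fixes \<kappa> :: "'i \<Rightarrow> 'a \<Rightarrow> real"
  assumes [measurable]: "\<And>i. \<kappa> i \<in> borel_measurable M"
  shows "(\<lambda>\<omega>. insort_key (\<lambda>i. \<kappa> i \<omega>) a l) \<in> M \<rightarrow>\<^sub>M count_space UNIV"
proof (induction l)
  case (Cons b l)
  note Cons.IH [measurable]
  have "(\<lambda>\<omega>. b # insort_key (\<lambda>i. \<kappa> i \<omega>) a l) \<in> M \<rightarrow>\<^sub>M count_space UNIV"
    by (rule measurable_compose[OF Cons.IH]) simp
  then show ?case by simp measurable
qed simp

lemma measurable_sort_key:
  fixes \<kappa> :: "'i::countable \<Rightarrow> 'a \<Rightarrow> real"
  assumes "\<And>i. \<kappa> i \<in> borel_measurable M"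
  shows "(\<lambda>\<omega>. sort_key (\<lambda>i. \<kappa> i \<omega>) l) \<in> M \<rightarrow>\<^sub>M count_space UNIV"
proof (induction l)
  case (Cons b l)
  from measurable_compose_countable[OF measurable_insort_key[OF assms] Cons.IH]
  show ?case by simp
qed simp

lemma sort_key_map: "sort_key f (map g xs) = map g (sort_key (\<lambda>x. f (g x)) xs)"
proof -
  have insort: "insort_key f (g a) (map g ys) = map g (insort_key (\<lambda>x. f (g x)) a ys)" for a ys
    by (induction ys) auto
  show ?thesis by (induction xs) (auto simp: insort)
qed

lemma measurable_length_filter_le_key:
  fixes x :: "'i \<Rightarrow> 'a \<Rightarrow> real" and t :: "'a \<Rightarrow> real"
  assumes [measurable]: "\<And>i. x i \<in> borel_measurable M" "t \<in> borel_measurable M"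
  shows "(\<lambda>\<omega>. length (filter (\<lambda>i. x i \<omega> \<le> t \<omega>) l)) \<in> M \<rightarrow>\<^sub>M count_space UNIV"
proof (induction l)
  case (Cons a l)
  note Cons.IH [measurable]
  have "(\<lambda>\<omega>. if x a \<omega> \<le> t \<omega> then Suc (length (filter (\<lambda>i. x i \<omega> \<le> t \<omega>) l))
      else length (filter (\<lambda>i. x i \<omega> \<le> t \<omega>) l)) \<in> M \<rightarrow>\<^sub>M count_space UNIV"
    by measurable
  then show ?case by (simp add: if_distrib cong: if_cong)
qed simp

text \<open>Each projection's variational inequality is tested at the other; coordinatewise the
  remaining gap is the square of \<open>(z - z') - (u - v)\<close>. The resulting continuity of
  \<open>iso\<close> gives its measurability.\<close>

lemma iso_nonexpansive:
  assumes len: "length z' = length z"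
  shows "(\<Sum>i<length z. (iso z ! i - iso z' ! i)\<^sup>2) \<le> (\<Sum>i<length z. (z!i - z'!i)\<^sup>2)"
proof -
  let ?n = "length z" and ?u = "\<lambda>i. iso z ! i" and ?v = "\<lambda>i. iso z' ! i"
  have 1: "(\<Sum>i<?n. (z!i - ?u i) * (?v i - ?u i)) \<le> 0"
    using iso_obtuse[of z ?v] iso_mono[of z'] len by simp
  have 2: "(\<Sum>i<?n. (z'!i - ?v i) * (?u i - ?v i)) \<le> 0"
    using iso_obtuse[of z' ?u] iso_mono[of z] len by simp
  have "(\<Sum>i<?n. (?u i - ?v i)\<^sup>2) \<le> (\<Sum>i<?n. (z!i - z'!i)\<^sup>2
     + 2 * ((z!i - ?u i) * (?v i - ?u i)) + 2 * ((z'!i - ?v i) * (?u i - ?v i)))"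
  proof (rule sum_mono)
    fix i
    have "0 \<le> ((z!i - z'!i) - (?u i - ?v i))\<^sup>2" by simp
    then show "(?u i - ?v i)\<^sup>2 \<le> (z!i - z'!i)\<^sup>2
     + 2 * ((z!i - ?u i) * (?v i - ?u i)) + 2 * ((z'!i - ?v i) * (?u i - ?v i))"
      by (simp add: power2_eq_square algebra_simps)
  qed
  also have "\<dots> = (\<Sum>i<?n. (z!i - z'!i)\<^sup>2) + 2 * (\<Sum>i<?n. (z!i - ?u i) * (?v i - ?u i))
     + 2 * (\<Sum>i<?n. (z'!i - ?v i) * (?u i - ?v i))"
    by (simp add: sum.distrib sum_distrib_left)
  finally show ?thesis using 1 2 by simp
qed

lemma continuous_on_iso_nth:
  assumes "i < n"
  shows "continuous_on UNIV (\<lambda>f. iso (map f [0..<n]) ! i)"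
proof -
  have "((\<lambda>f. iso (map f [0..<n]) ! i) \<longlongrightarrow> iso (map f0 [0..<n]) ! i) (at f0)" for f0 :: "nat \<Rightarrow> real"
  proof (subst tendsto_dist_iff, rule tendsto_sandwich[OF _ _ tendsto_const])
    have coord: "((\<lambda>f. f j) \<longlongrightarrow> f0 j) (at f0)" for j
    proof -
      have "continuous_on UNIV (\<lambda>f::nat \<Rightarrow> real. f j)" by (rule continuous_on_product_coordinates)
      then show ?thesis by (simp add: continuous_on_def)
    qed
    have "((\<lambda>f. sqrt (\<Sum>j<n. (f j - f0 j)\<^sup>2)) \<longlongrightarrow> sqrt (\<Sum>j<n. (f0 j - f0 j)\<^sup>2)) (at f0)"
      by (intro tendsto_intros coord)
    then show "((\<lambda>f. sqrt (\<Sum>j<n. (f j - f0 j)\<^sup>2)) \<longlongrightarrow> 0) (at f0)" by simp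
    have "dist (iso (map f [0..<n]) ! i) (iso (map f0 [0..<n]) ! i) \<le> sqrt (\<Sum>j<n. (f j - f0 j)\<^sup>2)" for f
    proof -
      have "(iso (map f [0..<n]) ! i - iso (map f0 [0..<n]) ! i)\<^sup>2
          \<le> (\<Sum>j<n. (iso (map f [0..<n]) ! j - iso (map f0 [0..<n]) ! j)\<^sup>2)"
        using assms by (intro member_le_sum) auto
      also have "\<dots> \<le> (\<Sum>j<n. (f j - f0 j)\<^sup>2)"
        using iso_nonexpansive[of "map f0 [0..<n]" "map f [0..<n]"] by simp
      finally show ?thesis by (simp add: dist_real_def real_le_rsqrt)
    qed
    then show "\<forall>\<^sub>F f in at f0. dist (iso (map f [0..<n]) ! i) (iso (map f0 [0..<n]) ! i)
       \<le> sqrt (\<Sum>j<n. (f j - f0 j)\<^sup>2)" by simp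
  qed simp
  then show ?thesis by (simp add: continuous_on_def)
qed

section \<open>Measurability of list-valued maps and of the iterates\<close>

definition list_measurable :: "'a measure \<Rightarrow> nat \<Rightarrow> ('a \<Rightarrow> real list) \<Rightarrow> bool" where
  "list_measurable M n F \<longleftrightarrow>
     (\<forall>\<omega>. length (F \<omega>) = n) \<and> (\<forall>i<n. (\<lambda>\<omega>. F \<omega> ! i) \<in> borel_measurable M)"

lemma list_measurable_iso:
  assumes F: "list_measurable M n F"
  shows "list_measurable M n (\<lambda>\<omega>. iso (F \<omega>))"
proof -
  have len: "length (F \<omega>) = n" for \<omega> using F by (simp add: list_measurable_def)
  have "(\<lambda>\<omega>. iso (F \<omega>) ! i) \<in> borel_measurable M" if "i < n" for i
  proof -
    \<comment> \<open>Padding with 0 beyond \<open>n\<close> turns lists into functions, whose Borel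
      measurability can be checked by coordinates.\<close>
    have "(\<lambda>\<omega> j. if j < n then F \<omega> ! j else 0) \<in> borel_measurable M"
    proof (rule measurable_coordinatewise_then_product)
      show "(\<lambda>\<omega>. if j < n then F \<omega> ! j else 0) \<in> borel_measurable M" for j
        using F by (cases "j < n") (auto simp: list_measurable_def)
    qed
    from measurable_compose[OF this borel_measurable_continuous_onI[OF continuous_on_iso_nth[OF that]]]
    have "(\<lambda>\<omega>. iso (map (\<lambda>j. if j < n then F \<omega> ! j else 0) [0..<n]) ! i) \<in> borel_measurable M" .
    moreover have "map (\<lambda>j. if j < n then F \<omega> ! j else 0) [0..<n] = F \<omega>" for \<omega>
      by (rule nth_equalityI) (simp_all add: len)
    ultimately show ?thesis by simp
  qed
  with len show ?thesis by (simp add: list_measurable_def)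
qed

lemma list_measurable_uminus:
  "list_measurable M n F \<Longrightarrow> list_measurable M n (\<lambda>\<omega>. map uminus (F \<omega>))"
  by (simp add: list_measurable_def)

lemma list_measurable_anti:
  "list_measurable M n F \<Longrightarrow> list_measurable M n (\<lambda>\<omega>. anti (F \<omega>))"
  unfolding anti_eq_iso by (intro list_measurable_uminus list_measurable_iso)

lemma list_measurable_vminus:
  "list_measurable M n F \<Longrightarrow> list_measurable M n G \<Longrightarrow> list_measurable M n (\<lambda>\<omega>. vminus (F \<omega>) (G \<omega>))"
  by (auto simp: list_measurable_def intro!: borel_measurable_diff)

lemma list_measurable_vplus:
  "list_measurable M n F \<Longrightarrow> list_measurable M n G \<Longrightarrow> list_measurable M n (\<lambda>\<omega>. vplus (F \<omega>) (G \<omega>))"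
  by (auto simp: list_measurable_def intro!: borel_measurable_add)

lemma list_measurable_iir_r:
  assumes F: "list_measurable M n F"
  shows "list_measurable M n (\<lambda>\<omega>. iir_r (F \<omega>) k)"
proof -
  have b: "list_measurable M n (\<lambda>\<omega>. iir_b (F \<omega>) k)" for k
  proof (induction k)
    case 0
    with F show ?case by (simp add: list_measurable_def)
  next
    case (Suc k)
    then show ?case
      using F by (simp add: list_measurable_anti list_measurable_vminus list_measurable_iso)
  qed
  show ?thesis
    unfolding iir_r_def iir_u_def
    using F b by (intro list_measurable_vplus list_measurable_iso list_measurable_vminus)
qed

text \<open>The sorting permutation, separated from the sorted values: it ranges over a countable
  type, so measurability can be checked for each fixed permutation.\<close>

definition sample_order :: "nat \<Rightarrow> (nat \<Rightarrow> real) \<Rightarrow> nat list" where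
  "sample_order n x = sort_key x [0..<n]"

lemma set_sample_order [simp]: "set (sample_order n x) = {..<n}"
  and length_sample_order [simp]: "length (sample_order n x) = n"
  by (auto simp: sample_order_def)

lemma ordered_sample_eq: "ordered_sample n \<omega> = map \<omega> (sample_order n (\<lambda>i. fst (\<omega> i)))"
  by (simp add: ordered_sample_def sample_order_def sort_key_map)

lemma sample_order_cong: "(\<And>i. i < n \<Longrightarrow> x i = x' i) \<Longrightarrow> sample_order n x = sample_order n x'"
proof -
  assume eq: "\<And>i. i < n \<Longrightarrow> x i = x' i"
  have insort: "insort_key x a ys = insort_key x' a ys" if "a < n" "set ys \<subseteq> {..<n}" for a ys
    using that by (induction ys) (auto simp: eq)
  have "sort_key x xs = sort_key x' xs" if "set xs \<subseteq> {..<n}" for xs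
    using that by (induction xs) (auto simp: insort)
  from this[of "[0..<n]"] show ?thesis by (simp add: sample_order_def atLeast0LessThan)
qed

text \<open>Two discrete quantities are fixed in turn, the permutation and the step index; what
  remains is one coordinate of the iterate. The point \<open>t\<close> may itself depend on
  \<omega>, which later yields joint measurability in the sample and the point.\<close>

lemma measurable_step_estimator:
  fixes x y :: "nat \<Rightarrow> 'a \<Rightarrow> real" and t :: "'a \<Rightarrow> real"
  assumes x: "\<And>i. x i \<in> borel_measurable M" and y: "\<And>i. y i \<in> borel_measurable M"
    and t: "t \<in> borel_measurable M"
  shows "(\<lambda>\<omega>. step_index (map (\<lambda>i. x i \<omega>) (sample_order n (\<lambda>i. x i \<omega>))) (t \<omega>)) \<in> M \<rightarrow>\<^sub>M count_space UNIV"
    and "n > 0 \<Longrightarrow> (\<lambda>\<omega>. step_fun (map (\<lambda>i. x i \<omega>) (sample_order n (\<lambda>i. x i \<omega>)))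
      (iir_r (map (\<lambda>i. y i \<omega>) (sample_order n (\<lambda>i. x i \<omega>))) k) (t \<omega>)) \<in> borel_measurable M"
proof -
  have order: "(\<lambda>\<omega>. sample_order n (\<lambda>i. x i \<omega>)) \<in> M \<rightarrow>\<^sub>M count_space UNIV"
    unfolding sample_order_def by (rule measurable_sort_key[OF x])
  have index: "(\<lambda>\<omega>. step_index (map (\<lambda>i. x i \<omega>) l) (t \<omega>)) \<in> M \<rightarrow>\<^sub>M count_space UNIV" for l
    using measurable_length_filter_le_key[OF x t, where l = "tl l"]
    by (simp add: step_index_def filter_map comp_def flip: map_tl)
  show *: "(\<lambda>\<omega>. step_index (map (\<lambda>i. x i \<omega>) (sample_order n (\<lambda>i. x i \<omega>))) (t \<omega>)) \<in> M \<rightarrow>\<^sub>M count_space UNIV"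
    by (rule measurable_compose_countable[OF index order])
  assume n: "n > 0"
  have val: "(\<lambda>\<omega>. iir_r (map (\<lambda>i. y i \<omega>) l) k ! min j (length l - 1)) \<in> borel_measurable M"
    if "l \<noteq> []" for l j
    using list_measurable_iir_r[of M "length l" "\<lambda>\<omega>. map (\<lambda>i. y i \<omega>) l" k] y that
    by (simp add: list_measurable_def min_less_iff_disj)
  \<comment> \<open>The dummy list \<open>[0]\<close> and the clamped index keep every access in
    range; on the actual permutation neither changes anything.\<close>
  define f where "f l \<omega> = iir_r (map (\<lambda>i. y i \<omega>) (if l = [] then [0] else l)) k !
      min (step_index (map (\<lambda>i. x i \<omega>) l) (t \<omega>)) (length (if l = [] then [0] else l) - 1)" for l \<omega>
  have "f l \<in> borel_measurable M" for l
    unfolding f_def by (rule measurable_compose_countable[OF val index]) simp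
  from measurable_compose_countable[OF this order]
  have "(\<lambda>\<omega>. f (sample_order n (\<lambda>i. x i \<omega>)) \<omega>) \<in> borel_measurable M" .
  moreover have "f (sample_order n (\<lambda>i. x i \<omega>)) \<omega> = step_fun (map (\<lambda>i. x i \<omega>) (sample_order n (\<lambda>i. x i \<omega>)))
      (iir_r (map (\<lambda>i. y i \<omega>) (sample_order n (\<lambda>i. x i \<omega>))) k) (t \<omega>)" for \<omega>
  proof -
    have ne: "sample_order n (\<lambda>i. x i \<omega>) \<noteq> []"
      using n length_sample_order[of n "\<lambda>i. x i \<omega>"] by (cases "sample_order n (\<lambda>i. x i \<omega>)") (simp_all only: list.size list.distinct not_False_eq_True)
    then have "step_index (map (\<lambda>i. x i \<omega>) (sample_order n (\<lambda>i. x i \<omega>))) (t \<omega>) < n"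
      using step_index_less[of "map (\<lambda>i. x i \<omega>) (sample_order n (\<lambda>i. x i \<omega>))"] by simp
    with ne show ?thesis by (simp add: f_def step_fun_def flip: step_index_def)
  qed
  ultimately show "(\<lambda>\<omega>. step_fun (map (\<lambda>i. x i \<omega>) (sample_order n (\<lambda>i. x i \<omega>)))
      (iir_r (map (\<lambda>i. y i \<omega>) (sample_order n (\<lambda>i. x i \<omega>))) k) (t \<omega>)) \<in> borel_measurable M" by simp
qed

lemma measurable_iir_estimator:
  assumes D: "sets D = sets (borel :: (real \<times> real) measure)"
  shows "(\<lambda>\<omega>. step_index (map fst (ordered_sample n \<omega>)) t) \<in> PiM {..<n} (\<lambda>_. D) \<rightarrow>\<^sub>M count_space UNIV"
    and "n > 0 \<Longrightarrow> (\<lambda>(\<omega>, t). iir_estimator n k \<omega> t) \<in> borel_measurable (PiM {..<n} (\<lambda>_. D) \<Otimes>\<^sub>M borel)"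
proof -
  let ?N = "PiM {..<n} (\<lambda>_. D)"
  \<comment> \<open>Coordinates from \<open>n\<close> on are replaced by 0, as measurability is
    asked for every index; the sorted sample does not see them.\<close>
  define x where "x i \<omega> = (if i < n then fst (\<omega> i) else 0)" for i and \<omega> :: "nat \<Rightarrow> real \<times> real"
  define y where "y i \<omega> = (if i < n then snd (\<omega> i) else 0)" for i and \<omega> :: "nat \<Rightarrow> real \<times> real"
  have comp: "(\<lambda>\<omega>. \<omega> i) \<in> ?N \<rightarrow>\<^sub>M borel" if "i < n" for i
    using measurable_component_singleton[of i "{..<n}" "\<lambda>_. D"] that measurable_cong_sets[OF refl D, of ?N] by simp
  have x [measurable]: "x i \<in> borel_measurable ?N" for i
    using measurable_compose[OF comp borel_measurable_continuous_onI[OF continuous_on_fst[OF continuous_on_id]]] by (cases "i < n") (auto simp: x_def[abs_def])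
  have y [measurable]: "y i \<in> borel_measurable ?N" for i
    using measurable_compose[OF comp borel_measurable_continuous_onI[OF continuous_on_snd[OF continuous_on_id]]] by (cases "i < n") (auto simp: y_def[abs_def])
  have ordered: "map fst (ordered_sample n \<omega>) = map (\<lambda>i. x i \<omega>) (sample_order n (\<lambda>i. x i \<omega>))"
     "map snd (ordered_sample n \<omega>) = map (\<lambda>i. y i \<omega>) (sample_order n (\<lambda>i. x i \<omega>))" for \<omega>
  proof -
    have "sample_order n (\<lambda>i. x i \<omega>) = sample_order n (\<lambda>i. fst (\<omega> i))"
      by (rule sample_order_cong) (simp add: x_def)
    then show "map fst (ordered_sample n \<omega>) = map (\<lambda>i. x i \<omega>) (sample_order n (\<lambda>i. x i \<omega>))"
     "map snd (ordered_sample n \<omega>) = map (\<lambda>i. y i \<omega>) (sample_order n (\<lambda>i. x i \<omega>))"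
      by (auto simp: ordered_sample_eq x_def y_def)
  qed
  show "(\<lambda>\<omega>. step_index (map fst (ordered_sample n \<omega>)) t) \<in> ?N \<rightarrow>\<^sub>M count_space UNIV"
    unfolding ordered by (rule measurable_step_estimator(1)) (auto intro: x y)
  assume n: "n > 0"
  show "(\<lambda>(\<omega>, t). iir_estimator n k \<omega> t) \<in> borel_measurable (?N \<Otimes>\<^sub>M borel)"
    unfolding iir_estimator_def ordered split_beta'
    by (rule measurable_step_estimator(2)[where x = "\<lambda>i z. x i (fst z)" and y = "\<lambda>i z. y i (fst z)"])
      (auto intro: measurable_compose[OF measurable_fst x] measurable_compose[OF measurable_fst y] n)
qed

text \<open>If two different constants belong to the set, the difference of the two squares is
  affine in \<open>r\<close>, so \<open>r\<close> is Borel on the interval and every constant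
  belongs. Hence the set is everything or has at most one element.\<close>

lemma borel_set_of_square_shifts:
  fixes r :: "real \<Rightarrow> real"
  shows "{c. (\<lambda>t. indicator {p<..<q} t * (c - r t)\<^sup>2) \<in> borel_measurable borel} \<in> sets borel"
    (is "?C \<in> _")
proof (cases "\<exists>c\<in>?C. \<exists>c'\<in>?C. c \<noteq> c'")
  case True
  let ?i = "indicator {p<..<q} :: real \<Rightarrow> real"
  obtain c c' where c: "c \<noteq> c'" and [measurable]: "(\<lambda>t. ?i t * (c - r t)\<^sup>2) \<in> borel_measurable borel"
      "(\<lambda>t. ?i t * (c' - r t)\<^sup>2) \<in> borel_measurable borel"
    using True by auto
  have "?i t * r t = (?i t * (c\<^sup>2 - c'\<^sup>2) - (?i t * (c - r t)\<^sup>2 - ?i t * (c' - r t)\<^sup>2)) / (2 * (c - c'))" for t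
    using c by (auto simp: field_simps power2_eq_square)
  moreover have "(\<lambda>t. (?i t * (c\<^sup>2 - c'\<^sup>2) - (?i t * (c - r t)\<^sup>2 - ?i t * (c' - r t)\<^sup>2)) / (2 * (c - c')))
      \<in> borel_measurable borel" by measurable
  ultimately have [measurable]: "(\<lambda>t. ?i t * r t) \<in> borel_measurable borel" by simp
  have "?C = UNIV"
  proof (intro set_eqI iffI UNIV_I CollectI)
    fix d
    have eq: "(\<lambda>t. ?i t * (d - r t)\<^sup>2) = (\<lambda>t. ?i t * (d - ?i t * r t)\<^sup>2)" by (auto simp: indicator_def)
    show "(\<lambda>t. ?i t * (d - r t)\<^sup>2) \<in> borel_measurable borel" unfolding eq by measurable
  qed
  then show ?thesis by simp
next
  case False
  then have "?C \<subseteq> {SOME c. c \<in> ?C}"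
    by (metis (no_types, lifting) singleton_iff someI_ex subsetI)
  then have "finite ?C" using finite_subset by blast
  then show ?thesis by (rule borel_closed[OF finite_imp_closed])
qed

lemma step_index_locally_const:
  assumes "t \<notin> set xs"
  obtains p q :: rat where "of_rat p < t" "t < of_rat q" "step_index xs (of_rat p) = step_index xs (of_rat q)"
proof -
  obtain d where d: "d > 0" "\<And>s. s \<in> set xs \<Longrightarrow> d \<le> dist t s"
    using finite_set_avoid[of "set xs" t] assms by (metis finite_set)
  obtain p where p: "t - d < of_rat p" "of_rat p < t" using of_rat_dense[of "t - d" t] d by auto
  obtain q where q: "t < of_rat q" "of_rat q < t + d" using of_rat_dense[of t "t + d"] d by auto
  have "filter (\<lambda>s. s \<le> of_rat p) (tl xs) = filter (\<lambda>s. s \<le> of_rat q) (tl xs)"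
  proof (rule filter_cong[OF refl])
    fix s assume "s \<in> set (tl xs)"
    then have "s \<in> set xs" by (metis list.sel(2) list.set_sel(2))
    from d(2)[OF this] p q show "s \<le> of_rat p \<longleftrightarrow> s \<le> of_rat q" by (auto simp: dist_real_def abs_le_iff)
  qed
  then show ?thesis using that p q by (simp add: step_index_def)
qed

text \<open>Between rationals of equal index the step function is constant, and such intervals
  together with the design points cover the line. Measurability of the squared error thus becomes a
  countable conjunction of conditions on single values of the estimator, each a membership in a
  Borel set.\<close>

lemma step_sq_err_measurable_iff:
  fixes r :: "real \<Rightarrow> real"
  shows "(\<lambda>t. (step_fun xs v t - r t)\<^sup>2) \<in> borel_measurable borel \<longleftrightarrow>
    (\<forall>p q :: rat. p < q \<longrightarrow> step_index xs (of_rat p) = step_index xs (of_rat q) \<longrightarrow>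
      step_fun xs v (of_rat p) \<in>
        {c. (\<lambda>t. indicator {of_rat p<..<of_rat q} t * (c - r t)\<^sup>2) \<in> borel_measurable borel})"
    (is "?f \<in> _ \<longleftrightarrow> ?R")
proof -
  have const: "indicator {of_rat p<..<of_rat q} t * (step_fun xs v t - r t)\<^sup>2 =
      indicator {of_rat p<..<of_rat q} t * (step_fun xs v (of_rat p) - r t)\<^sup>2"
    if "step_index xs (of_rat p) = step_index xs (of_rat q)" for t and p q :: rat
  proof (cases "t \<in> {of_rat p<..<of_rat q}")
    case True
    then have "step_index xs t = step_index xs (of_rat p)"
      using step_index_mono[of "of_rat p" t xs] step_index_mono[of t "of_rat q" xs] that by auto
    then show ?thesis by (simp add: step_fun_def flip: step_index_def)
  qed simp
  show ?thesis
  proof (intro iffI allI impI CollectI)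
    fix p q :: rat assume f [measurable]: "?f \<in> borel_measurable borel"
      and pq: "step_index xs (of_rat p) = step_index xs (of_rat q)"
    have "(\<lambda>t. indicator {of_rat p<..<of_rat q} t * (step_fun xs v t - r t)\<^sup>2) \<in> borel_measurable borel"
      by measurable
    then show "(\<lambda>t. indicator {of_rat p<..<of_rat q} t * (step_fun xs v (of_rat p) - r t)\<^sup>2) \<in> borel_measurable borel"
      by (simp add: const[OF pq])
  next
    assume R: ?R
    define G :: "(rat \<times> rat) set" where "G = {(p, q). p < q \<and> step_index xs (of_rat p) = step_index xs (of_rat q)}"
    define C where "C = (\<lambda>(p, q). {of_rat p<..<of_rat q :: real}) ` G \<union> (\<lambda>x. {x}) ` set xs"
    show "?f \<in> borel_measurable borel"
    proof (rule measurable_piecewise_restrict)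
      show "countable C" by (simp add: C_def countable_finite)
      show "\<Omega> \<inter> space borel \<in> sets borel" if "\<Omega> \<in> C" for \<Omega> using that by (auto simp: C_def)
      show "space borel \<subseteq> \<Union> C"
      proof
        fix t :: real
        show "t \<in> \<Union> C"
        proof (cases "t \<in> set xs")
          case False
          then obtain p q :: rat where "of_rat p < t" "t < of_rat q" "step_index xs (of_rat p) = step_index xs (of_rat q)"
            by (rule step_index_locally_const)
          moreover from this have "p < q" by (metis less_trans of_rat_less)
          ultimately show ?thesis by (force simp: C_def G_def)
        qed (auto simp: C_def)
      qed
      show "?f \<in> borel_measurable (restrict_space borel \<Omega>)" if "\<Omega> \<in> C" for \<Omega>
      proof -
        have "(\<lambda>t. indicator \<Omega> t * ?f t) \<in> borel_measurable borel"
          using that unfolding C_def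
        proof (elim UnE imageE)
          fix pq assume \<Omega>: "\<Omega> = (case pq of (p, q) \<Rightarrow> {of_rat p<..<of_rat q})" and "pq \<in> G"
          then obtain p q where pq: "pq = (p, q)" "p < q"
            and eq: "step_index xs (of_rat p) = step_index xs (of_rat q)" by (auto simp: G_def)
          show ?thesis using R pq eq unfolding \<Omega> pq prod.case const[OF eq] by blast
        next
          fix x assume \<Omega>: "\<Omega> = {x}"
          have eq: "(\<lambda>t. indicator \<Omega> t * ?f t) = (\<lambda>t. indicator \<Omega> t * ?f x)" by (auto simp: \<Omega> indicator_def)
          show ?thesis unfolding eq unfolding \<Omega> by measurable
        qed
        moreover have "\<Omega> \<inter> space borel \<in> sets borel" using that by (auto simp: C_def)
        ultimately show ?thesis by (simp add: borel_measurable_restrict_space_iff)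
      qed
    qed
  qed
qed

text \<open>When \<^term>\<open>r\<close> fails to be Borel outside the support of \<^term>\<open>\<mu>\<close>, the integral on the left is the
  junk value 0 for some samples; the set of these samples is measurable nevertheless.\<close>

lemma iir_sq_err:
  fixes r r' :: "real \<Rightarrow> real" and \<mu> :: "real measure"
  assumes mu: "prob_space \<mu>" "sets \<mu> = sets borel"
    and r' [measurable]: "r' \<in> borel_measurable borel" and r: "AE t in \<mu>. r t = r' t"
    and D: "sets D = sets (borel :: (real \<times> real) measure)"
  shows iir_sq_err_measurable:
      "n > 0 \<Longrightarrow> (\<lambda>\<omega>. \<integral>t. (iir_estimator n k \<omega> t - r t)\<^sup>2 \<partial>\<mu>) \<in> borel_measurable (PiM {..<n} (\<lambda>_. D))"
    and iir_sq_err_le: "(\<integral>t. (iir_estimator n k \<omega> t - r t)\<^sup>2 \<partial>\<mu>) \<le> (\<integral>t. (iir_estimator n k \<omega> t - r' t)\<^sup>2 \<partial>\<mu>)"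
proof -
  interpret mu: prob_space \<mu> by fact
  let ?N = "PiM {..<n} (\<lambda>_. D)"
  let ?E = "\<lambda>\<omega>. \<integral>t. (iir_estimator n k \<omega> t - r t)\<^sup>2 \<partial>\<mu>" and ?E' = "\<lambda>\<omega>. \<integral>t. (iir_estimator n k \<omega> t - r' t)\<^sup>2 \<partial>\<mu>"
  \<comment> \<open>On this event the loss equals the one for \<open>r'\<close>, and elsewhere it is
    0, so its measurability reduces to that of the event.\<close>
  define good where "good \<omega> \<longleftrightarrow> (\<lambda>t. (iir_estimator n k \<omega> t - r t)\<^sup>2) \<in> borel_measurable borel" for \<omega>
  have step [measurable]: "iir_estimator n k \<omega> \<in> borel_measurable borel" for \<omega>
  proof -
    have "(\<lambda>t. v ! step_index xs t) \<in> borel_measurable borel" for v xs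
      unfolding step_index_def by (rule measurable_compose[OF measurable_length_filter_le]) simp
    then show ?thesis by (simp add: iir_estimator_def step_fun_def[abs_def] flip: step_index_def)
  qed
  have E: "?E \<omega> = (if good \<omega> then ?E' \<omega> else 0)" for \<omega>
  proof (cases "good \<omega>")
    case True
    then have [measurable]: "(\<lambda>t. (iir_estimator n k \<omega> t - r t)\<^sup>2) \<in> borel_measurable borel" by (simp add: good_def)
    have "?E \<omega> = ?E' \<omega>"
      using r mu(2) by (intro integral_cong_AE) (auto simp: measurable_cong_sets[OF mu(2) refl])
    then show ?thesis using True by simp
  next
    case False
    then have "\<not> integrable \<mu> (\<lambda>t. (iir_estimator n k \<omega> t - r t)\<^sup>2)"
      using measurable_cong_sets[OF mu(2) refl] by (auto simp: good_def dest!: borel_measurable_integrable)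
    then show ?thesis using False by (simp add: not_integrable_integral_eq)
  qed
  show "?E \<omega> \<le> ?E' \<omega>" by (simp add: E)
  assume n: "n > 0"
  note est [measurable] = measurable_iir_estimator(2)[OF D n, of k]
  have at [measurable]: "(\<lambda>\<omega>. iir_estimator n k \<omega> t) \<in> borel_measurable ?N" for t
    using measurable_compose[OF measurable_Pair2'[of t borel ?N] est] by simp
  note idx [measurable] = measurable_iir_estimator(1)[OF D]
  define C where "C p q = {c. (\<lambda>t. indicator {of_rat p<..<of_rat q} t * (c - r t)\<^sup>2) \<in> borel_measurable borel}" for p q :: rat
  have [measurable]: "C p q \<in> sets borel" for p q
    unfolding C_def by (rule borel_set_of_square_shifts)
  have "Measurable.pred ?N good"
  proof -
    define c where "c p \<omega> = step_index (map fst (ordered_sample n \<omega>)) (of_rat p)" for p \<omega>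
    define g where "g p \<omega> = iir_estimator n k \<omega> (of_rat p)" for p \<omega>
    have [measurable]: "c p \<in> ?N \<rightarrow>\<^sub>M count_space UNIV" "g p \<in> borel_measurable ?N" for p
      unfolding c_def g_def by (rule idx, rule at)
    have "Measurable.pred ?N (\<lambda>\<omega>. \<forall>p q :: rat. p < q \<longrightarrow> c p \<omega> = c q \<omega> \<longrightarrow> g p \<omega> \<in> C p q)"
      by measurable
    then show ?thesis
      by (simp add: good_def[abs_def] iir_estimator_def step_sq_err_measurable_iff C_def c_def g_def)
  qed
  moreover have "?E' \<in> borel_measurable ?N"
  proof (rule mu.borel_measurable_lebesgue_integral)
    have "(\<lambda>z. ((\<lambda>(\<omega>, t). iir_estimator n k \<omega> t) z - r' (snd z))\<^sup>2) \<in> borel_measurable (?N \<Otimes>\<^sub>M borel)"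
      by (intro borel_measurable_power borel_measurable_diff est measurable_compose[OF measurable_snd r'])
    then have "(\<lambda>(\<omega>, t). (iir_estimator n k \<omega> t - r' t)\<^sup>2) \<in> borel_measurable (?N \<Otimes>\<^sub>M borel)"
      by (simp only: split_beta')
    moreover have "sets (?N \<Otimes>\<^sub>M borel) = sets (?N \<Otimes>\<^sub>M \<mu>)"
      by (intro sets_pair_measure_cong refl mu(2)[symmetric])
    ultimately show "(\<lambda>(\<omega>, t). (iir_estimator n k \<omega> t - r' t)\<^sup>2) \<in> borel_measurable (?N \<Otimes>\<^sub>M \<mu>)"
      by (simp only: measurable_cong_sets[of "?N \<Otimes>\<^sub>M borel" "?N \<Otimes>\<^sub>M \<mu>" borel borel])
  qed
  ultimately show "?E \<in> borel_measurable ?N"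
    unfolding E by measurable
qed

section \<open>Bounded variation and bins\<close>

text \<open>Jordan decomposition: \<open>p\<close> is the variation of \<open>r\<close> on
  \<open>[0, x]\<close>, and \<open>q\<close> is \<open>r\<close> minus that variation. Both are
  composed with the retraction onto the unit interval, because they are needed monotone and bounded
  on the whole line.\<close>

lemma bounded_variation_jordan:
  assumes "bounded_variation_on r 0 1"
  obtains p q :: "real \<Rightarrow> real" and B where "mono p" "antimono q" "\<And>t. \<bar>p t\<bar> \<le> B" "\<And>t. \<bar>q t\<bar> \<le> B"
    "\<And>t. t \<in> {0..1} \<Longrightarrow> r t = p t + q t"
proof -
  define vs where "vs ts = (\<Sum>i<length ts - 1. \<bar>r (ts ! Suc i) - r (ts ! i)\<bar>)" for ts
  obtain B where B: "\<And>ts. sorted ts \<Longrightarrow> set ts \<subseteq> {0..1} \<Longrightarrow> vs ts \<le> B"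
    using assms by (auto simp: bounded_variation_on_def vs_def)
  define V where "V x = (SUP ts\<in>{ts. sorted ts \<and> set ts \<subseteq> {0..x}}. vs ts)" for x
  have bdd: "bdd_above (vs ` {ts. sorted ts \<and> set ts \<subseteq> {0..x}})" if "x \<le> 1" for x
    using that by (intro bdd_aboveI[of _ B]) (auto intro!: B)
  have V_upper: "vs ts \<le> V x" if "x \<le> 1" "sorted ts" "set ts \<subseteq> {0..x}" for x ts
    unfolding V_def using that by (intro cSUP_upper bdd) auto
  have V_step: "V x + \<bar>r y - r x\<bar> \<le> V y" if "0 \<le> x" "x \<le> y" "y \<le> 1" for x y
  proof -
    have "V x \<le> V y - \<bar>r y - r x\<bar>"
      unfolding V_def[of x]
    proof (rule cSUP_least)
      show "{ts. sorted ts \<and> set ts \<subseteq> {0..x}} \<noteq> {}" by (auto intro: exI[of _ "[]"])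
      fix ts assume ts: "ts \<in> {ts. sorted ts \<and> set ts \<subseteq> {0..x}}"
      \<comment> \<open>Appending both x and y isolates the increment from x to y; the bridge from
        the last point of \<open>ts\<close> to x only adds a nonnegative term.\<close>
      let ?ts = "ts @ [x, y]"
      let ?g = "\<lambda>i. \<bar>r (?ts ! Suc i) - r (?ts ! i)\<bar>"
      have "vs ts = (\<Sum>i<length ts - 1. ?g i)"
        unfolding vs_def by (intro sum.cong) (auto simp: nth_append)
      also have "\<dots> \<le> (\<Sum>i<length ts. ?g i)"
        by (intro sum_mono2) auto
      also have "\<dots> + \<bar>r y - r x\<bar> = (\<Sum>i<Suc (length ts). ?g i)"
        by (simp add: nth_append)
      also have "\<dots> = vs ?ts" by (simp add: vs_def)
      also have "vs ?ts \<le> V y"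
        using ts that by (intro V_upper) (auto simp: sorted_append)
      finally show "vs ts \<le> V y - \<bar>r y - r x\<bar>" by simp
    qed
    then show ?thesis by simp
  qed
  have V0: "0 \<le> V x" if "x \<le> 1" for x using V_upper[OF that, of "[]"] by (simp add: vs_def)
  have VB: "V x \<le> B" if "x \<le> 1" for x
    unfolding V_def using that by (intro cSUP_least) (auto intro!: B intro: exI[of _ "[]"])
  define cl where "cl t = max 0 (min 1 t)" for t :: real
  have cl: "0 \<le> cl t" "cl t \<le> 1" "s \<le> t \<Longrightarrow> cl s \<le> cl t" "t \<in> {0..1} \<Longrightarrow> cl t = t" for s t
    by (auto simp: cl_def)
  show ?thesis
  proof
    show "mono (\<lambda>t. V (cl t))"
    proof (rule monoI)
      fix s t :: real assume "s \<le> t"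
      with V_step[of "cl s" "cl t"] cl show "V (cl s) \<le> V (cl t)" by force
    qed
    show "antimono (\<lambda>t. r (cl t) - V (cl t))"
    proof (rule antimonoI)
      fix s t :: real assume "s \<le> t"
      with V_step[of "cl s" "cl t"] cl show "r (cl t) - V (cl t) \<le> r (cl s) - V (cl s)" by force
    qed
    fix t
    have V: "0 \<le> V (cl t)" "V (cl t) \<le> B" using V0 VB cl(2) by auto
    then show "\<bar>V (cl t)\<bar> \<le> \<bar>r 0\<bar> + 2 * B" by simp
    have "\<bar>r (cl t) - r 0\<bar> \<le> B" using V_step[of 0 "cl t"] V V0[of 0] cl by force
    with V show "\<bar>r (cl t) - V (cl t)\<bar> \<le> \<bar>r 0\<bar> + 2 * B" by linarith
    show "t \<in> {0..1} \<Longrightarrow> r t = V (cl t) + (r (cl t) - V (cl t))" using cl(4) by simp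
  qed
qed

text \<open>Without atoms the distribution function is continuous, so quantiles at the levels j / m
  exist. The bin of x is the number of quantiles below x, which makes the bins the intervals between
  consecutive quantiles.\<close>

lemma nonatomic_bins:
  fixes \<mu> :: "real measure"
  assumes mu: "prob_space \<mu>" "sets \<mu> = sets borel" and na: "\<And>x. measure \<mu> {x} = 0" and m: "m > 0"
  obtains \<beta> :: "real \<Rightarrow> nat" where "mono \<beta>" "\<And>t. \<beta> t < m" "\<beta> \<in> borel \<rightarrow>\<^sub>M count_space UNIV"
    "\<And>j. measure \<mu> {t. \<beta> t = j} \<le> 1 / m"
proof -
  interpret mu: prob_space \<mu> by fact
  interpret mu: real_distribution \<mu>
    using mu(2) by unfold_locales
  have space: "space \<mu> = UNIV" using sets_eq_imp_space_eq[OF mu(2)] by simp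
  have ex: "\<exists>t. cdf \<mu> t = real j / m" if "0 < j" "j < m" for j
  proof -
    have y: "0 < real j / m" "real j / m < 1" using that by auto
    have "\<forall>\<^sub>F x in at_bot. cdf \<mu> x < real j / m" "\<forall>\<^sub>F x in at_top. real j / m < cdf \<mu> x"
      using order_tendstoD(2)[OF mu.cdf_lim_at_bot y(1)] order_tendstoD(1)[OF mu.cdf_lim_at_top_prob y(2)] by auto
    then obtain a b where ab: "cdf \<mu> a < real j / m" "real j / m < cdf \<mu> b"
      using eventually_happens' trivial_limit_at_bot_linorder trivial_limit_at_top_linorder by metis
    then have "a \<le> b" using mu.cdf_nondecreasing[of b a] by linarith
    moreover have "continuous_on {a..b} (cdf \<mu>)"
      using mu.isCont_cdf na by (intro continuous_at_imp_continuous_on) auto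
    ultimately show ?thesis using IVT'[of "cdf \<mu>" a "real j / m" b] ab by force
  qed
  then obtain t where t: "\<And>j. 0 < j \<Longrightarrow> j < m \<Longrightarrow> cdf \<mu> (t j) = real j / m" by metis
  \<comment> \<open>The quantiles are arbitrary choices; they are ordered because their levels
    strictly increase.\<close>
  have t_mono: "t i \<le> t j" if "0 < i" "i \<le> j" "j < m" for i j
  proof (rule ccontr)
    assume "\<not> t i \<le> t j"
    then have less: "t j < t i" by simp
    then have "real i / m \<ge> real j / m" using mu.cdf_nondecreasing[of "t j" "t i"] t that by auto
    then have "i = j" using that m by (simp add: field_simps divide_le_cancel)
    with less show False by simp
  qed
  define T where "T x = {i\<in>{1..<m}. t i < x}" for x
  define \<beta> where "\<beta> x = card (T x)" for x
  have fin: "finite (T x)" for x by (simp add: T_def)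
  have \<beta>_sum: "\<beta> x = (\<Sum>i\<in>{1..<m}. if t i < x then 1 else 0)" for x
    by (simp add: \<beta>_def T_def sum.If_cases Int_def)
  have lower: "t (\<beta> x) < x" if "0 < \<beta> x" for x
  proof (rule ccontr)
    assume n: "\<not> t (\<beta> x) < x"
    have "T x \<subseteq> {1..<\<beta> x}"
    proof
      fix i assume i: "i \<in> T x"
      have "i < \<beta> x"
      proof (rule ccontr)
        assume "\<not> i < \<beta> x"
        then have "t (\<beta> x) \<le> t i" using i that by (intro t_mono) (auto simp: T_def)
        with n i show False by (auto simp: T_def)
      qed
      with i show "i \<in> {1..<\<beta> x}" by (auto simp: T_def)
    qed
    from card_mono[OF _ this] that show False by (simp add: \<beta>_def)
  qed
  have upper: "x \<le> t (Suc (\<beta> x))" if "Suc (\<beta> x) < m" for x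
  proof (rule ccontr)
    assume n: "\<not> x \<le> t (Suc (\<beta> x))"
    have "{1..Suc (\<beta> x)} \<subseteq> T x"
    proof
      fix i assume i: "i \<in> {1..Suc (\<beta> x)}"
      then have "t i \<le> t (Suc (\<beta> x))" using that by (intro t_mono) auto
      with i n that show "i \<in> T x" by (auto simp: T_def)
    qed
    from card_mono[OF fin this] show False by (simp add: \<beta>_def)
  qed
  have \<beta>m: "\<beta> x < m" for x
  proof -
    have "card (T x) \<le> card {1..<m}" by (intro card_mono) (auto simp: T_def)
    then show ?thesis using m by (simp add: \<beta>_def)
  qed
  have meas [measurable]: "\<beta> \<in> borel \<rightarrow>\<^sub>M count_space UNIV"
    unfolding \<beta>_sum[abs_def] by measurable
  show ?thesis
  proof
    show "mono \<beta>"
      unfolding \<beta>_def by (intro monoI card_mono fin) (auto simp: T_def)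
    show "\<beta> \<in> borel \<rightarrow>\<^sub>M count_space UNIV" by (rule meas)
    show "\<beta> x < m" for x by (rule \<beta>m)
    fix j
    let ?A = "{x. \<beta> x = j}"
    \<comment> \<open>The first and the last bin are half-lines, and for m = 1 there is no quantile
      at all.\<close>
    consider "j \<ge> m" | "j = 0" "m = 1" | "j = 0" "1 < m" | "0 < j" "Suc j < m" | "0 < j" "Suc j = m" by linarith
    then show "measure \<mu> ?A \<le> 1 / m"
    proof cases
      case 1
      then have "?A = {}" using \<beta>m by (auto simp: not_less[symmetric])
      then show ?thesis by simp
    next
      case 2
      then show ?thesis by simp
    next
      case 3
      have "x \<le> t 1" if "\<beta> x = 0" for x using upper[of x] that 3 by simp
      then have "?A \<subseteq> {..t 1}" using 3 by auto
      then have "measure \<mu> ?A \<le> cdf \<mu> (t 1)"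
        unfolding cdf_def by (intro mu.finite_measure_mono) (auto simp: mu(2))
      then show ?thesis using t[of 1] 3 by simp
    next
      case 4
      have "t j < x \<and> x \<le> t (Suc j)" if "\<beta> x = j" for x
        using upper[of x] lower[of x] that 4 by simp
      then have "?A \<subseteq> {t j<..t (Suc j)}" by auto
      then have "measure \<mu> ?A \<le> measure \<mu> {t j<..t (Suc j)}"
        by (intro mu.finite_measure_mono) (auto simp: mu(2))
      also have "\<dots> = cdf \<mu> (t (Suc j)) - cdf \<mu> (t j)"
      proof (cases "t j = t (Suc j)")
        case False
        then have "t j < t (Suc j)" using t_mono[of j "Suc j"] 4 by auto
        then show ?thesis using mu.cdf_diff_eq by simp
      qed simp
      also have "\<dots> = 1 / m" using t 4 by (simp add: field_simps)
      finally show ?thesis .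
    next
      case 5
      have "t j < x" if "\<beta> x = j" for x using lower[of x] that 5 by simp
      then have "?A \<subseteq> space \<mu> - {..t j}" unfolding space by (metis (mono_tags, lifting) DiffI UNIV_I atMost_iff mem_Collect_eq not_le subsetI)
      then have "measure \<mu> ?A \<le> measure \<mu> (space \<mu> - {..t j})"
        by (intro mu.finite_measure_mono) (auto simp: mu(2))
      also have "\<dots> = 1 - cdf \<mu> (t j)" unfolding cdf_def by (rule mu.prob_compl) (simp add: mu(2))
      also have "\<dots> = 1 / m" using t[of j] 5 by (simp add: field_simps)
      finally show ?thesis .
    qed
  qed
qed

section \<open>Mean absolute value of centred sample averages\<close>

lemma sample_mean_abs:
  fixes D :: "'b measure" and \<phi> :: "'b \<Rightarrow> real" and n :: nat
  assumes D: "prob_space D" and \<phi>: "\<phi> \<in> borel_measurable D" and c: "AE z in D. \<bar>\<phi> z\<bar> \<le> c"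
    and zero: "(\<integral>z. \<phi> z \<partial>D) = 0" and n: "n > 0"
  shows sample_mean_abs_integrable: "integrable (PiM {..<n} (\<lambda>_. D)) (\<lambda>\<omega>. \<bar>(\<Sum>i<n. \<phi> (\<omega> i)) / n\<bar>)"
    and sample_mean_abs_le: "(\<integral>\<omega>. \<bar>(\<Sum>i<n. \<phi> (\<omega> i)) / n\<bar> \<partial>PiM {..<n} (\<lambda>_. D)) \<le> (c\<^sup>2 + 1) / (2 * sqrt n)"
proof -
  let ?N = "PiM {..<n} (\<lambda>_. D)"
  interpret D: prob_space D by fact
  interpret product_sigma_finite "\<lambda>_::nat. D" by standard
  interpret N: prob_space ?N by (rule prob_space_PiM) (rule D)
  have [measurable]: "(\<lambda>\<omega>. \<phi> (\<omega> i)) \<in> borel_measurable ?N" if "i < n" for i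
    using measurable_compose[OF measurable_component_singleton[of i "{..<n}" "\<lambda>_. D"] \<phi>] that by simp
  have bd: "AE \<omega> in ?N. \<bar>\<phi> (\<omega> i)\<bar> \<le> c" if "i < n" for i
    using AE_PiM_component[of "{..<n}" "\<lambda>_. D" i "\<lambda>z. \<bar>\<phi> z\<bar> \<le> c"] D c that by simp
  have int: "integrable ?N (\<lambda>\<omega>. \<phi> (\<omega> i) * \<phi> (\<omega> j))" if "i < n" "j < n" for i j
  proof (rule N.integrable_const_bound[of _ "c * c"])
    show "AE \<omega> in ?N. norm (\<phi> (\<omega> i) * \<phi> (\<omega> j)) \<le> c * c"
      using bd[OF that(1)] bd[OF that(2)] by eventually_elim (auto simp: abs_mult intro!: mult_mono)
    show "(\<lambda>\<omega>. \<phi> (\<omega> i) * \<phi> (\<omega> j)) \<in> borel_measurable ?N" using that by measurable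
  qed
  have int_\<phi>: "integrable D \<phi>" using \<phi> c by (intro D.integrable_const_bound[of _ c]) auto
  have off: "(\<integral>\<omega>. \<phi> (\<omega> i) * \<phi> (\<omega> j) \<partial>?N) = 0" if "i < n" "j < n" "i \<noteq> j" for i j
  proof -
    \<comment> \<open>The factor 1 at all other coordinates makes a full product out of two factors,
      so that independence applies; the integrals at i and j are 0.\<close>
    let ?f = "\<lambda>l z. if l = i \<or> l = j then \<phi> z else 1"
    have "(\<Prod>l<n. ?f l (\<omega> l)) = \<phi> (\<omega> i) * \<phi> (\<omega> j)" for \<omega>
    proof -
      have "(\<Prod>l<n. ?f l (\<omega> l)) = (\<Prod>l\<in>{i, j}. ?f l (\<omega> l))"
        using that by (intro prod.mono_neutral_right) auto
      then show ?thesis using that by simp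
    qed
    then have "(\<integral>\<omega>. \<phi> (\<omega> i) * \<phi> (\<omega> j) \<partial>?N) = (\<integral>\<omega>. (\<Prod>l<n. ?f l (\<omega> l)) \<partial>?N)" by simp
    also have "\<dots> = (\<Prod>l<n. \<integral>z. ?f l z \<partial>D)"
    proof (rule product_integral_prod)
      show "integrable D (?f l)" for l using int_\<phi> by (cases "l = i \<or> l = j") auto
    qed simp
    also have "\<dots> = 0" using that zero by (intro prod_zero) (auto intro: bexI[of _ i])
    finally show ?thesis .
  qed
  have diag: "(\<integral>\<omega>. \<phi> (\<omega> i) * \<phi> (\<omega> i) \<partial>?N) \<le> c\<^sup>2" if "i < n" for i
  proof -
    have "AE \<omega> in ?N. \<phi> (\<omega> i) * \<phi> (\<omega> i) \<le> c\<^sup>2"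
      using bd[OF that] by eventually_elim (auto simp: abs_le_square_iff simp flip: power2_eq_square intro: power2_le_imp_le dest: power_mono[where n = 2])
    then have "(\<integral>\<omega>. \<phi> (\<omega> i) * \<phi> (\<omega> i) \<partial>?N) \<le> (\<integral>\<omega>. c\<^sup>2 \<partial>?N)"
      using int[OF that that] by (intro integral_mono_AE) auto
    then show ?thesis by (simp add: N.prob_space)
  qed
  define S where "S \<omega> = (\<Sum>i<n. \<phi> (\<omega> i))" for \<omega>
  have S2: "(S \<omega>)\<^sup>2 = (\<Sum>i<n. \<Sum>j<n. \<phi> (\<omega> i) * \<phi> (\<omega> j))" for \<omega>
    by (simp add: S_def power2_eq_square sum_product)
  have S2_int: "integrable ?N (\<lambda>\<omega>. (S \<omega>)\<^sup>2)"
    unfolding S2 by (intro Bochner_Integration.integrable_sum int) auto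
  have "(\<integral>\<omega>. (S \<omega>)\<^sup>2 \<partial>?N) = (\<Sum>i<n. \<Sum>j<n. \<integral>\<omega>. \<phi> (\<omega> i) * \<phi> (\<omega> j) \<partial>?N)"
    unfolding S2 by (subst Bochner_Integration.integral_sum, fastforce intro: int Bochner_Integration.integrable_sum)
      (intro sum.cong refl Bochner_Integration.integral_sum, auto intro: int)
  also have "\<dots> \<le> (\<Sum>i<n. \<Sum>j<n. if j = i then c\<^sup>2 else 0)"
    using diag off by (intro sum_mono) auto
  also have "\<dots> = n * c\<^sup>2" by simp
  finally have S2_le: "(\<integral>\<omega>. (S \<omega>)\<^sup>2 \<partial>?N) \<le> n * c\<^sup>2" .
  \<comment> \<open>The weight makes both terms of order \<open>1 / sqrt n\<close> once the second
    moment of \<open>S\<close> is at most \<open>n * c^2\<close>; integrability of the mean follows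
    from the same domination.\<close>
  have amgm: "\<bar>S \<omega> / n\<bar> \<le> ((S \<omega>)\<^sup>2 / (n * sqrt n) + 1 / sqrt n) / 2" for \<omega>
  proof -
    define s where "s = sqrt n"
    have s: "s > 0" "real n = s * s" using n by (auto simp: s_def)
    have "0 \<le> (\<bar>S \<omega>\<bar> - s)\<^sup>2" by simp
    then have "2 * \<bar>S \<omega>\<bar> * s \<le> (S \<omega>)\<^sup>2 + s * s" by (simp add: power2_eq_square algebra_simps)
    then show ?thesis using s by (simp add: field_simps power2_eq_square flip: s_def)
  qed
  have meas [measurable]: "S \<in> borel_measurable ?N"
    unfolding S_def[abs_def] by (intro borel_measurable_sum) auto
  have dom: "integrable ?N (\<lambda>\<omega>. ((S \<omega>)\<^sup>2 / (n * sqrt n) + 1 / sqrt n) / 2)"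
    using S2_int by (intro integrable_divide Bochner_Integration.integrable_add) auto
  show int_abs: "integrable ?N (\<lambda>\<omega>. \<bar>(\<Sum>i<n. \<phi> (\<omega> i)) / n\<bar>)"
    unfolding S_def[symmetric]
    by (rule Bochner_Integration.integrable_bound[OF dom]) (use amgm in \<open>auto intro!: AE_I2 intro: order_trans[OF _ abs_ge_self]\<close>)
  have "(\<integral>\<omega>. \<bar>S \<omega> / n\<bar> \<partial>?N) \<le> (\<integral>\<omega>. ((S \<omega>)\<^sup>2 / (n * sqrt n) + 1 / sqrt n) / 2 \<partial>?N)"
    using int_abs amgm by (intro integral_mono dom) (auto simp: S_def)
  also have "\<dots> = ((\<integral>\<omega>. (S \<omega>)\<^sup>2 \<partial>?N) / (n * sqrt n) + 1 / sqrt n) / 2"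
    using S2_int by (simp add: N.prob_space)
  also have "\<dots> \<le> ((n * c\<^sup>2) / (n * sqrt n) + 1 / sqrt n) / 2"
    using S2_le n by (intro divide_right_mono add_right_mono) auto
  also have "\<dots> = (c\<^sup>2 + 1) / (2 * sqrt n)" using n by (simp add: field_simps)
  finally show "(\<integral>\<omega>. \<bar>(\<Sum>i<n. \<phi> (\<omega> i)) / n\<bar> \<partial>?N) \<le> (c\<^sup>2 + 1) / (2 * sqrt n)"
    by (simp add: S_def)
qed

section \<open>Convergence of the risk\<close>

lemma length_ordered_sample [simp]: "length (ordered_sample n \<omega>) = n"
  by (simp add: ordered_sample_def)

lemma sum_ordered_sample:
  fixes G :: "real \<times> real \<Rightarrow> real"
  shows "(\<Sum>i<n. G (ordered_sample n \<omega> ! i)) = (\<Sum>i<n. G (\<omega> i))"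
proof -
  have "mset (map G (ordered_sample n \<omega>)) = mset (map G (map \<omega> [0..<n]))"
    by (simp add: ordered_sample_def image_mset.compositionality comp_def)
  then have "sum_list (map G (ordered_sample n \<omega>)) = sum_list (map G (map \<omega> [0..<n]))"
    by (metis sum_mset_sum_list)
  then show ?thesis by (simp add: sum_list_sum_nth atLeast0LessThan)
qed

lemma bin_discrepancy_eq:
  assumes "n > 0"
  shows "bin_discrepancy \<mu> \<beta> m n x e = (\<Sum>j<m.
    \<bar>(\<Sum>i<n. (if \<beta> (x i) = j then 1 else 0) - measure \<mu> {t. \<beta> t = j}) / n\<bar> +
    \<bar>(\<Sum>i<n. if \<beta> (x i) = j then e i else 0) / n\<bar>)"
proof -
  have "real (card {i. i < n \<and> \<beta> (x i) = j}) / n - c = (\<Sum>i<n. (if \<beta> (x i) = j then 1 else 0) - c) / n" for j c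
    using assms by (simp add: sum_subtractf sum.If_cases Int_def field_simps)
  moreover have "(\<Sum>i | i < n \<and> \<beta> (x i) = j. e i) = (\<Sum>i<n. if \<beta> (x i) = j then e i else 0)" for j
    by (simp add: sum.If_cases Int_def)
  ultimately show ?thesis by (simp add: bin_discrepancy_def)
qed

text \<open>In each bin the frequency error is a mean of variables bounded by 1 and the noise a mean
  of variables bounded by \<open>C\<close>, so together they cost
  \<open>(1 + 1) / (2 * sqrt n) + (C^2 + 1) / (2 * sqrt n)\<close>. The hypothesis
  \<open>centred\<close> is the vanishing conditional mean, tested on Borel sets of the design
  variable.\<close>

lemma iir_risk_bound:
  fixes \<mu> :: "real measure" and p q r :: "real \<Rightarrow> real" and D :: "(real \<times> real) measure"
    and m n k :: nat and B C \<delta> :: real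
  assumes mu: "prob_space \<mu>" "sets \<mu> = sets borel"
    and \<beta>: "mono \<beta>" "\<And>t. \<beta> t < m" "\<beta> \<in> borel \<rightarrow>\<^sub>M count_space UNIV"
    and \<delta>: "\<And>j. measure \<mu> {t. \<beta> t = j} \<le> \<delta>"
    and p: "mono p" "\<And>t. \<bar>p t\<bar> \<le> B" and q: "antimono q" "\<And>t. \<bar>q t\<bar> \<le> B"
    and r: "AE t in \<mu>. r t = p t + q t"
    and D: "prob_space D" "sets D = sets borel" "distr D borel fst = \<mu>"
    and C: "AE z in D. \<bar>snd z - p (fst z) - q (fst z)\<bar> \<le> C"
    and centred: "\<And>A. A \<in> sets borel \<Longrightarrow>
      (\<integral>z. indicator A (fst z) * (snd z - p (fst z) - q (fst z)) \<partial>D) = 0"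
    and k: "k \<ge> 1" and n: "n > 0"
  defines "W \<equiv> 2 * B + 4 * real k * (2 * B + C)"
  shows "integrable (PiM {..<n} (\<lambda>_. D)) (\<lambda>\<omega>. \<integral>t. (iir_estimator n k \<omega> t - r t)\<^sup>2 \<partial>\<mu>)" (is ?I)
    and "(\<integral>\<omega>. (\<integral>t. (iir_estimator n k \<omega> t - r t)\<^sup>2 \<partial>\<mu>) \<partial>PiM {..<n} (\<lambda>_. D)) \<le>
      B\<^sup>2 / (2 * real k) + (3 * W + 6 * C * W + 8 * W\<^sup>2) * (\<delta> + m * (3 + C\<^sup>2) / (2 * sqrt n))" (is ?J)
proof -
  let ?N = "PiM {..<n} (\<lambda>_. D)"
  let ?E = "\<lambda>\<omega>. \<integral>t. (iir_estimator n k \<omega> t - r t)\<^sup>2 \<partial>\<mu>"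
  interpret D: prob_space D by fact
  interpret N: prob_space ?N by (rule prob_space_PiM) (rule D)
  define e where "e z = snd z - p (fst z) - q (fst z)" for z
  define K where "K = 3 * W + 6 * C * W + 8 * W\<^sup>2"
  note \<beta>(3) [measurable]
  have pq [measurable]: "p \<in> borel_measurable borel" "q \<in> borel_measurable borel"
    using p(1) q(1) borel_measurable_mono[of p] borel_measurable_mono[of "\<lambda>t. - q t"]
    by (auto simp: mono_def antimono_def)
  have fst_D [measurable]: "fst \<in> D \<rightarrow>\<^sub>M borel" and snd_D [measurable]: "snd \<in> D \<rightarrow>\<^sub>M borel"
    unfolding measurable_cong_sets[OF D(2) refl]
    by (intro borel_measurable_continuous_onI continuous_intros)+
  have e_meas [measurable]: "e \<in> borel_measurable D" unfolding e_def[abs_def] by measurable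
  have B0: "0 \<le> B" using p(2)[of 0] by linarith
  have C0: "0 \<le> C"
  proof -
    have "AE z in D. 0 \<le> C" using C by eventually_elim auto
    then show ?thesis by simp
  qed
  have W0: "0 \<le> W" using B0 C0 by (simp add: W_def)
  have K0: "0 \<le> K" using W0 C0 by (simp add: K_def)
  define \<phi> where "\<phi> j z = (if \<beta> (fst z) = j then 1 else 0) - measure \<mu> {t. \<beta> t = j}" for j and z :: "real \<times> real"
  define \<psi> where "\<psi> j z = (if \<beta> (fst z) = j then e z else 0)" for j z
  have \<phi>: "\<phi> j \<in> borel_measurable D" "AE z in D. \<bar>\<phi> j z\<bar> \<le> 1" "(\<integral>z. \<phi> j z \<partial>D) = 0" for j
  proof -
    show "\<phi> j \<in> borel_measurable D" unfolding \<phi>_def[abs_def] by measurable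
    interpret mu: prob_space \<mu> by fact
    show "AE z in D. \<bar>\<phi> j z\<bar> \<le> 1" by (intro AE_I2) (auto simp: \<phi>_def)
    have [measurable]: "{t. \<beta> t = j} \<in> sets borel" by measurable
    have "measure \<mu> {t. \<beta> t = j} = measure D (fst -` {t. \<beta> t = j} \<inter> space D)"
      using fst_D by (subst D(3)[symmetric], subst measure_distr) auto
    also have "\<dots> = (\<integral>z. indicator (fst -` {t. \<beta> t = j} \<inter> space D) z \<partial>D)" by simp
    also have "\<dots> = (\<integral>z. (if \<beta> (fst z) = j then 1 else 0) \<partial>D)"
      by (intro Bochner_Integration.integral_cong) (auto simp: indicator_def)
    finally have "(\<integral>z. (if \<beta> (fst z) = j then 1 else 0) \<partial>D) = measure \<mu> {t. \<beta> t = j}" by simp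
    moreover have "integrable D (\<lambda>z. (if \<beta> (fst z) = j then 1 else 0 :: real))"
      by (intro D.integrable_const_bound[of _ 1]) auto
    ultimately show "(\<integral>z. \<phi> j z \<partial>D) = 0" by (simp add: \<phi>_def D.prob_space)
  qed
  have \<psi>: "\<psi> j \<in> borel_measurable D" "AE z in D. \<bar>\<psi> j z\<bar> \<le> C" "(\<integral>z. \<psi> j z \<partial>D) = 0" for j
  proof -
    show "\<psi> j \<in> borel_measurable D" unfolding \<psi>_def[abs_def] by measurable
    show "AE z in D. \<bar>\<psi> j z\<bar> \<le> C" using C by eventually_elim (use C0 in \<open>auto simp: \<psi>_def e_def\<close>)
    have "{t. \<beta> t = j} \<in> sets borel" by measurable
    moreover have eq: "indicator {t. \<beta> t = j} (fst z) * e z = \<psi> j z" for z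
      by (simp add: \<psi>_def)
    ultimately show "(\<integral>z. \<psi> j z \<partial>D) = 0"
      using centred[of "{t. \<beta> t = j}"] unfolding e_def[symmetric] eq by blast
  qed
  define Z where "Z \<omega> = (\<Sum>j<m. \<bar>(\<Sum>i<n. \<phi> j (\<omega> i)) / n\<bar> + \<bar>(\<Sum>i<n. \<psi> j (\<omega> i)) / n\<bar>)" for \<omega>
  have Z_int: "integrable ?N Z"
    unfolding Z_def[abs_def]
    by (intro Bochner_Integration.integrable_sum Bochner_Integration.integrable_add
      sample_mean_abs_integrable[OF D(1) \<phi> n] sample_mean_abs_integrable[OF D(1) \<psi> n])
  have "(\<integral>\<omega>. Z \<omega> \<partial>?N) = (\<Sum>j<m. (\<integral>\<omega>. \<bar>(\<Sum>i<n. \<phi> j (\<omega> i)) / n\<bar> \<partial>?N) + (\<integral>\<omega>. \<bar>(\<Sum>i<n. \<psi> j (\<omega> i)) / n\<bar> \<partial>?N))"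
    unfolding Z_def
    using sample_mean_abs_integrable[OF D(1) \<phi> n] sample_mean_abs_integrable[OF D(1) \<psi> n]
    by (subst Bochner_Integration.integral_sum) (auto intro!: sum.cong Bochner_Integration.integral_add)
  also have "\<dots> \<le> (\<Sum>j<m. (1\<^sup>2 + 1) / (2 * sqrt n) + (C\<^sup>2 + 1) / (2 * sqrt n))"
    by (intro sum_mono add_mono sample_mean_abs_le[OF D(1) \<phi> n] sample_mean_abs_le[OF D(1) \<psi> n])
  also have "\<dots> = m * (3 + C\<^sup>2) / (2 * sqrt n)"
    by (simp add: add_divide_distrib algebra_simps)
  finally have Z_le: "(\<integral>\<omega>. Z \<omega> \<partial>?N) \<le> m * (3 + C\<^sup>2) / (2 * sqrt n)" .
  \<comment> \<open>The noise is bounded only almost surely, so the pointwise bound on the loss is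
    confined to this event.\<close>
  have bounded: "AE \<omega> in ?N. \<forall>i<n. \<bar>e (\<omega> i)\<bar> \<le> C"
  proof -
    have "AE \<omega> in ?N. \<bar>e (\<omega> i)\<bar> \<le> C" if "i \<in> {..<n}" for i
      using AE_PiM_component[of "{..<n}" "\<lambda>_. D" i "\<lambda>z. \<bar>e z\<bar> \<le> C"] D(1) C that by (simp add: e_def)
    then have "AE \<omega> in ?N. \<forall>i\<in>{..<n}. \<bar>e (\<omega> i)\<bar> \<le> C" by (intro AE_finite_allI) auto
    then show ?thesis by (simp add: lessThan_def)
  qed
  let ?bound = "\<lambda>\<omega>. B\<^sup>2 / (2 * real k) + K * (\<delta> + Z \<omega>)"
  have E_le: "?E \<omega> \<le> ?bound \<omega>" if \<omega>: "\<forall>i<n. \<bar>e (\<omega> i)\<bar> \<le> C" for \<omega>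
  proof -
    let ?os = "ordered_sample n \<omega>"
    let ?xs = "map fst ?os" and ?ys = "map snd ?os"
    have "set ?os = \<omega> ` {..<n}" by (auto simp: ordered_sample_def)
    then have e: "\<bar>e z\<bar> \<le> C" if "z \<in> set ?os" for z using \<omega> that by auto
    have "?E \<omega> \<le> (\<integral>t. (iir_estimator n k \<omega> t - (p t + q t))\<^sup>2 \<partial>\<mu>)"
      by (rule iir_sq_err_le[OF mu _ r D(2)]) measurable
    also have "\<dots> \<le> B\<^sup>2 / (2 * real k) + (3 * W + 6 * C * W + 8 * W\<^sup>2) *
        (\<delta> + bin_discrepancy \<mu> \<beta> m (length ?xs) ((!) ?xs) (\<lambda>i. ?ys!i - p (?xs!i) - q (?xs!i)))"
      unfolding iir_estimator_def W_def
    proof (rule iir_error_bound[OF mu \<beta> \<delta> p q _ _ _ k])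
      show "sorted ?xs" by (simp add: ordered_sample_def)
      show "?xs \<noteq> []" using n length_ordered_sample[of n \<omega>] by (metis length_map length_0_conv less_irrefl)
      show "\<bar>?ys!i - p (?xs!i) - q (?xs!i)\<bar> \<le> C" if "i < length ?xs" for i
        using e[of "?os!i"] that by (simp add: e_def)
    qed simp
    also have "bin_discrepancy \<mu> \<beta> m (length ?xs) ((!) ?xs) (\<lambda>i. ?ys!i - p (?xs!i) - q (?xs!i)) = Z \<omega>"
    proof -
      have "(\<Sum>i<n. (if \<beta> (?xs!i) = j then 1 else 0) - measure \<mu> {t. \<beta> t = j}) = (\<Sum>i<n. \<phi> j (?os!i))" for j
        by (intro sum.cong) (auto simp: \<phi>_def)
      moreover have "(\<Sum>i<n. if \<beta> (?xs!i) = j then ?ys!i - p (?xs!i) - q (?xs!i) else 0) = (\<Sum>i<n. \<psi> j (?os!i))" for j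
        by (intro sum.cong) (auto simp: \<psi>_def e_def)
      ultimately show ?thesis
        using n by (simp only: bin_discrepancy_eq length_map length_ordered_sample Z_def sum_ordered_sample)
    qed
    finally show ?thesis by (simp add: K_def)
  qed
  have dom: "integrable ?N ?bound" using Z_int by simp
  have E_meas: "?E \<in> borel_measurable ?N"
    by (rule iir_sq_err_measurable[OF mu _ r D(2) n]) measurable
  show ?I
  proof (rule Bochner_Integration.integrable_bound[OF dom E_meas])
    show "AE \<omega> in ?N. norm (?E \<omega>) \<le> norm (?bound \<omega>)"
      using bounded
    proof eventually_elim
      case (elim \<omega>)
      have "0 \<le> ?E \<omega>" by (rule Bochner_Integration.integral_nonneg) simp
      with E_le[OF elim] show ?case by simp
    qed
  qed
  then have "(\<integral>\<omega>. ?E \<omega> \<partial>?N) \<le> (\<integral>\<omega>. ?bound \<omega> \<partial>?N)"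
    by (rule integral_mono_AE[OF _ dom]) (use bounded in eventually_elim, rule E_le)
  also have "\<dots> = B\<^sup>2 / (2 * real k) + K * (\<delta> + (\<integral>\<omega>. Z \<omega> \<partial>?N))"
    using Z_int by (simp add: N.prob_space)
  also have "\<dots> \<le> B\<^sup>2 / (2 * real k) + K * (\<delta> + m * (3 + C\<^sup>2) / (2 * sqrt n))"
    using Z_le K0 by (intro add_left_mono mult_left_mono) auto
  finally show ?J by (simp add: K_def)
qed

text \<open>For each k the bound holds from some threshold on; \<open>\<kappa> n\<close> is the
  largest k whose threshold \<open>n\<close> has passed.\<close>

lemma diagonal_sequence:
  fixes E :: "nat \<Rightarrow> nat \<Rightarrow> real"
  assumes E: "\<And>k. k \<ge> 1 \<Longrightarrow> \<forall>\<^sub>F n in sequentially. E n k \<le> A / real k" and nonneg: "\<And>n k. 0 \<le> E n k"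
  obtains \<kappa> :: "nat \<Rightarrow> nat" where "mono \<kappa>" "\<And>n. 1 \<le> \<kappa> n" "(\<lambda>n. E n (\<kappa> n)) \<longlonglongrightarrow> 0"
proof -
  from E have "\<forall>k. \<exists>N. k \<ge> 1 \<longrightarrow> (\<forall>n\<ge>N. E n k \<le> A / real k)" by (auto simp: eventually_sequentially)
  then obtain N where N: "\<And>k n. k \<ge> 1 \<Longrightarrow> n \<ge> N k \<Longrightarrow> E n k \<le> A / real k" by metis
  \<comment> \<open>Summing the thresholds makes \<open>M\<close> increasing, and adding k leaves
    only finitely many k with \<open>M k \<le> n\<close>.\<close>
  define M where "M k = k + (\<Sum>j\<le>k. N j)" for k
  have M: "k \<le> M k" "N k \<le> M k" "j \<le> k \<Longrightarrow> M j \<le> M k" for j k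
  proof -
    have "N k \<le> (\<Sum>j\<le>k. N j)" by (rule member_le_sum) auto
    then show "N k \<le> M k" by (simp add: M_def)
    assume "j \<le> k"
    then show "M j \<le> M k" unfolding M_def by (intro add_mono sum_mono2) auto
  qed (simp add: M_def)
  define S where "S n = insert 1 {k. 1 \<le> k \<and> M k \<le> n}" for n
  have fin: "finite (S n)" for n
  proof -
    have "{k. 1 \<le> k \<and> M k \<le> n} \<subseteq> {..n}" using M(1) order_trans by blast
    then show ?thesis using finite_subset by (auto simp: S_def)
  qed
  define \<kappa> where "\<kappa> n = Max (S n)" for n
  have \<kappa>: "\<kappa> n \<in> S n" "k \<in> S n \<Longrightarrow> k \<le> \<kappa> n" for n k
  proof -
    have "S n \<noteq> {}" by (simp add: S_def)
    then show "\<kappa> n \<in> S n" unfolding \<kappa>_def by (rule Max_in[OF fin])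
    show "k \<in> S n \<Longrightarrow> k \<le> \<kappa> n" unfolding \<kappa>_def by (rule Max_ge[OF fin])
  qed
  have A0: "0 \<le> A"
    using N[of 1 "N 1"] nonneg[of "N 1" 1] by simp
  have bound: "E n (\<kappa> n) \<le> A / real K" if "K \<ge> 1" "n \<ge> M K" for n K
  proof -
    have K: "K \<le> \<kappa> n" using that by (intro \<kappa>(2)) (auto simp: S_def)
    \<comment> \<open>Here \<open>n\<close> has passed \<open>M 1\<close>, so the default member 1
      of \<open>S n\<close> meets the condition as well.\<close>
    have "M (\<kappa> n) \<le> n" using \<kappa>(1)[of n] M(3)[of 1 K] that by (auto simp: S_def)
    then have "E n (\<kappa> n) \<le> A / real (\<kappa> n)" using N[of "\<kappa> n" n] M(2)[of "\<kappa> n"] K that by auto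
    also have "\<dots> \<le> A / real K" using K that A0 by (intro divide_left_mono) auto
    finally show ?thesis .
  qed
  show ?thesis
  proof
    show "mono \<kappa>"
      unfolding \<kappa>_def by (intro monoI Max_mono fin) (auto simp: S_def)
    show "1 \<le> \<kappa> n" for n by (rule \<kappa>(2)) (simp add: S_def)
    show "(\<lambda>n. E n (\<kappa> n)) \<longlonglongrightarrow> 0"
    proof (rule LIMSEQ_I)
      fix \<epsilon> :: real assume \<epsilon>: "\<epsilon> > 0"
      obtain K where K: "A / \<epsilon> < real K" using reals_Archimedean2 by blast
      then have K1: "K \<ge> 1" using A0 \<epsilon> by (cases K) (auto simp: divide_less_0_iff not_less[symmetric])
      then have "A / real K < \<epsilon>" using K \<epsilon> by (simp add: field_simps)
      then show "\<exists>no. \<forall>n\<ge>no. norm (E n (\<kappa> n) - 0) < \<epsilon>"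
        using bound[OF K1] nonneg by (intro exI[of _ "M K"]) (auto intro: le_less_trans)
    qed
  qed
qed

text \<open>Since \<^term>\<open>r\<close> may fail to be Borel off \<open>{0..1}\<close>, the pair \<open>(X, r X + \<epsilon>)\<close> need not be measurable; its
  distribution is then the null measure.\<close>

lemma emeasure_distr_nonmeasurable:
  assumes "f \<in> space M \<rightarrow> space N" and "f \<notin> M \<rightarrow>\<^sub>M N" and "emeasure M (space M) \<noteq> 0" "emeasure M (space M) \<noteq> \<infinity>"
  shows "emeasure (distr M N f) A = 0"
proof (rule ccontr)
  let ?m = "\<lambda>A. emeasure M (f -` A \<inter> space M)"
  assume "emeasure (distr M N f) A \<noteq> 0"
  \<comment> \<open>A nonzero value means that the preimage set function is a measure. A set with
    nonmeasurable preimage and its complement then both get 0, since \<open>emeasure\<close>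
    vanishes off the sigma-algebra, against the nonzero total mass.\<close>
  then have ms: "measure_space (space N) (sets N) ?m"
    unfolding distr_def by (auto simp: emeasure_measure_of_conv sets.sigma_sets_eq split: if_splits)
  obtain A where A: "A \<in> sets N" "f -` A \<inter> space M \<notin> sets M"
    using assms(1,2) by (auto simp: measurable_def)
  have compl: "space M - (f -` A \<inter> space M) = f -` (space N - A) \<inter> space M"
    using assms(1) by auto
  have "f -` (space N - A) \<inter> space M \<notin> sets M"
  proof
    assume "f -` (space N - A) \<inter> space M \<in> sets M"
    then have "space M - (space M - (f -` A \<inter> space M)) \<in> sets M" unfolding compl[symmetric] by (rule sets.compl_sets)
    moreover have "space M - (space M - (f -` A \<inter> space M)) = f -` A \<inter> space M" by blast
    ultimately show False using A(2) by simp
  qed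
  then have 0: "?m A = 0" "?m (space N - A) = 0" using A(2) by (simp_all add: emeasure_notin_sets)
  have add: "?m (A \<union> (space N - A)) = ?m A + ?m (space N - A)"
  proof -
    have "additive (sets N) ?m"
      using ms sets.countably_additive_additive by (auto simp: measure_space_def)
    from this[unfolded Measure_Space.additive_def, rule_format, of A "space N - A"] A(1)
    show ?thesis by auto
  qed
  have un: "A \<union> (space N - A) = space N" using A(1) sets.sets_into_space by blast
  have "?m (space N) = 0" using add unfolding un 0 by simp
  moreover have "f -` space N \<inter> space M = space M" using assms(1) by auto
  ultimately show False using assms(3) by simp
qed

text \<open>The total mass is the n-th power of that of \<open>D\<close>; for n = 0 this would be 1,
  and that case is treated apart.\<close>

lemma emeasure_PiM_null:
  assumes D: "emeasure D (space D) = 0" and n: "n > (0::nat)"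
  shows "emeasure (PiM {..<n} (\<lambda>_. D)) (space (PiM {..<n} (\<lambda>_. D))) = 0"
proof -
  interpret finite_measure D by (rule finite_measureI) (simp add: D)
  interpret product_sigma_finite "\<lambda>_::nat. D" by standard
  have "emeasure (PiM {..<n} (\<lambda>_. D)) (PiE {..<n} (\<lambda>_. space D)) = (\<Prod>i<n. emeasure D (space D))"
    by (rule emeasure_PiM) auto
  also have "\<dots> = 0" using n by (simp add: D)
  finally show ?thesis by (simp add: space_PiM)
qed

text \<open>Without observations the estimator does not depend on \<omega>, so the loss is constant
  on a probability space, whatever value indexing an empty list has.\<close>

lemma iir_sq_err_integrable_0:
  "integrable (PiM {..<0::nat} (\<lambda>_. D)) (\<lambda>\<omega>. \<integral>t. (iir_estimator 0 k \<omega> t - r t)\<^sup>2 \<partial>\<mu>)"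
proof -
  interpret prob_space "PiM {..<0::nat} (\<lambda>_. D)" by (rule prob_space_PiM) simp
  have "iir_estimator 0 k \<omega> = step_fun [] (iir_r [] k)" for \<omega>
    by (simp add: iir_estimator_def ordered_sample_def)
  then show ?thesis by (simp only: integrable_const)
qed

text \<open>Integrability of the loss is part of the claim because a nonintegrable function has
  integral 0 by convention, which would make the limit meaningless.\<close>

theorem theorem2:
  fixes \<mu> :: "real measure" and r :: "real \<Rightarrow> real"
    and M :: "'a measure" and X \<epsilon> :: "'a \<Rightarrow> real"
  assumes mu_prob: "prob_space \<mu>" and mu_sets: "sets \<mu> = sets borel"
    and mu_support: "measure \<mu> {0..1} = 1"
    and mu_nonatomic: "\<And>x. measure \<mu> {x} = 0"
    and r_rc: "right_continuous_on r 0 1"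
    and r_bv: "bounded_variation_on r 0 1"
    and M_prob: "prob_space M"
    and X_meas: "X \<in> borel_measurable M" and X_distr: "distr M borel X = \<mu>"
    and eps_meas: "\<epsilon> \<in> borel_measurable M"
    and eps_bounded: "\<exists>C. AE \<omega> in M. \<bar>\<epsilon> \<omega>\<bar> \<le> C"
    and eps_cond: "AE \<omega> in M. real_cond_exp M (vimage_algebra (space M) X borel) \<epsilon> \<omega> = 0"
  shows "\<exists>k :: nat \<Rightarrow> nat. mono k \<and> (\<forall>n. 1 \<le> k n) \<and>
     (let D = distr M borel (\<lambda>\<omega>. (X \<omega>, r (X \<omega>) + \<epsilon> \<omega>));
          err = (\<lambda>n \<omega>. \<integral>x. (iir_estimator n (k n) \<omega> x - r x)\<^sup>2 \<partial>\<mu>)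
      in (\<forall>n. integrable (PiM {..<n} (\<lambda>_. D)) (err n)) \<and>
         (\<lambda>n. \<integral>\<omega>. err n \<omega> \<partial>(PiM {..<n} (\<lambda>_. D))) \<longlonglongrightarrow> 0)"
proof -
  define f where "f \<omega> = (X \<omega>, r (X \<omega>) + \<epsilon> \<omega>)" for \<omega>
  define D where "D = distr M (borel :: (real \<times> real) measure) f"
  have D_sets: "sets D = sets borel" by (simp add: D_def)
  define E where "E n k = (\<integral>\<omega>. (\<integral>t. (iir_estimator n k \<omega> t - r t)\<^sup>2 \<partial>\<mu>) \<partial>PiM {..<n} (\<lambda>_. D))" for n k
  interpret M: prob_space M by fact
  interpret mu: prob_space \<mu> by fact
  obtain p q B where p: "mono p" "\<And>t. \<bar>p t\<bar> \<le> B" and q: "antimono q" "\<And>t. \<bar>q t\<bar> \<le> B"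
    and pq: "\<And>t. t \<in> {0..1} \<Longrightarrow> r t = p t + q t"
    by (rule bounded_variation_jordan[OF r_bv]) (rule that)
  have [measurable]: "p \<in> borel_measurable borel" "q \<in> borel_measurable borel"
    using p(1) q(1) borel_measurable_mono[of p] borel_measurable_mono[of "\<lambda>t. - q t"]
    by (auto simp: mono_def antimono_def)
  note X_meas [measurable] eps_meas [measurable]
  have "AE t in \<mu>. t \<in> {0..1}"
    using mu_support mu_sets by (subst mu.AE_in_set_eq_1) auto
  then have r: "AE t in \<mu>. r t = p t + q t" by eventually_elim (rule pq)
  have nonneg: "0 \<le> E n k" for n k
    unfolding E_def by (intro Bochner_Integration.integral_nonneg) auto
  \<comment> \<open>Here k is fixed; \<open>B^2 + 1\<close> leaves room for two further terms of
    size \<open>1 / (2 * k)\<close> next to \<open>B^2 / (2 * k)\<close>.\<close>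
  have main: "(\<forall>n. integrable (PiM {..<n} (\<lambda>_. D)) (\<lambda>\<omega>. \<integral>t. (iir_estimator n k \<omega> t - r t)\<^sup>2 \<partial>\<mu>)) \<and>
      (\<forall>\<^sub>F n in sequentially. E n k \<le> (B\<^sup>2 + 1) / real k)" if k: "k \<ge> 1" for k
  proof (cases "f \<in> borel_measurable M")
    case False
    have D0: "emeasure D (space D) = 0"
      unfolding D_def using False by (intro emeasure_distr_nonmeasurable) (auto simp: M.emeasure_space_1)
    have *: "integrable (PiM {..<n} (\<lambda>_. D)) (\<lambda>\<omega>. \<integral>t. (iir_estimator n k \<omega> t - r t)\<^sup>2 \<partial>\<mu>) \<and> E n k = 0" if "n > 0" for n
    proof -
      let ?N = "PiM {..<n} (\<lambda>_. D)"
      have meas: "(\<lambda>\<omega>. \<integral>t. (iir_estimator n k \<omega> t - r t)\<^sup>2 \<partial>\<mu>) \<in> borel_measurable ?N"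
        by (rule iir_sq_err_measurable[OF mu_prob mu_sets _ r D_sets that]) measurable
      have AE: "AE \<omega> in ?N. (\<integral>t. (iir_estimator n k \<omega> t - r t)\<^sup>2 \<partial>\<mu>) = 0"
        using emeasure_PiM_null[OF D0 that] by (intro AE_I[of _ _ "space ?N"]) auto
      show ?thesis
      proof
        show "E n k = 0" unfolding E_def by (rule integral_eq_zero_AE) (rule AE)
        show "integrable ?N (\<lambda>\<omega>. \<integral>t. (iir_estimator n k \<omega> t - r t)\<^sup>2 \<partial>\<mu>)"
          by (subst integrable_cong_AE[OF meas _ AE]) auto
      qed
    qed
    have "\<forall>\<^sub>F n in sequentially. E n k \<le> (B\<^sup>2 + 1) / real k"
      using eventually_gt_at_top[of 0] by eventually_elim (simp add: *)
    moreover have "integrable (PiM {..<n} (\<lambda>_. D)) (\<lambda>\<omega>. \<integral>t. (iir_estimator n k \<omega> t - r t)\<^sup>2 \<partial>\<mu>)" for n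
    proof (cases "n = 0")
      case False
      then show ?thesis using * by blast
    qed (simp only: iir_sq_err_integrable_0)
    ultimately show ?thesis by blast
  next
    case True
    note True [measurable]
    obtain C where C: "AE \<omega> in M. \<bar>\<epsilon> \<omega>\<bar> \<le> C" using eps_bounded by blast
    have D_prob: "prob_space D" unfolding D_def by (rule M.prob_space_distr) (rule True)
    have fst_borel [measurable]: "(fst :: real \<times> real \<Rightarrow> real) \<in> borel_measurable borel"
      and snd_borel [measurable]: "(snd :: real \<times> real \<Rightarrow> real) \<in> borel_measurable borel"
      by (intro borel_measurable_continuous_onI continuous_intros)+
    have D_fst: "distr D borel fst = \<mu>"
      unfolding D_def X_distr[symmetric] by (subst distr_distr) (auto simp: comp_def f_def)
    \<comment> \<open>Almost surely X lies in the unit interval, where \<open>r = p + q\<close>, so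
      the response minus p and q is the noise.\<close>
    have e: "AE \<omega> in M. snd (f \<omega>) - p (fst (f \<omega>)) - q (fst (f \<omega>)) = \<epsilon> \<omega>"
    proof -
      have "AE t in distr M borel X. t \<in> {0..1}" unfolding X_distr by fact
      then have "AE \<omega> in M. X \<omega> \<in> {0..1}" by (subst (asm) AE_distr_iff) auto
      then show ?thesis by eventually_elim (simp add: f_def pq)
    qed
    have C_D: "AE z in D. \<bar>snd z - p (fst z) - q (fst z)\<bar> \<le> C"
      unfolding D_def
    proof (subst AE_distr_iff)
      show "AE \<omega> in M. \<bar>snd (f \<omega>) - p (fst (f \<omega>)) - q (fst (f \<omega>))\<bar> \<le> C"
        using e C by eventually_elim simp
    qed measurable
    have centred: "(\<integral>z. indicator A (fst z) * (snd z - p (fst z) - q (fst z)) \<partial>D) = 0"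
      if [measurable]: "A \<in> sets borel" for A
    proof -
      let ?F = "vimage_algebra (space M) X borel"
      have "subalgebra M ?F"
        using sets_vimage_algebra2[of X "space M" borel] measurable_sets[OF X_meas]
        by (auto simp: subalgebra_def)
      then interpret finite_measure_subalgebra M ?F by unfold_locales
      have A: "X -` A \<inter> space M \<in> sets ?F" by (rule in_vimage_algebra) fact
      have int: "integrable M \<epsilon>" using C by (intro M.integrable_const_bound[of _ C]) auto
      have "(\<integral>z. indicator A (fst z) * (snd z - p (fst z) - q (fst z)) \<partial>D) =
          (\<integral>\<omega>. indicator A (fst (f \<omega>)) * (snd (f \<omega>) - p (fst (f \<omega>)) - q (fst (f \<omega>))) \<partial>M)"
        unfolding D_def by (rule integral_distr) measurable
      also have "\<dots> = (\<integral>\<omega>. indicator (X -` A \<inter> space M) \<omega> * \<epsilon> \<omega> \<partial>M)"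
      proof (rule integral_cong_AE)
        show "AE \<omega> in M. indicator A (fst (f \<omega>)) * (snd (f \<omega>) - p (fst (f \<omega>)) - q (fst (f \<omega>)))
           = indicator (X -` A \<inter> space M) \<omega> * \<epsilon> \<omega>"
          using e AE_space by eventually_elim (auto simp: f_def indicator_def)
      qed measurable
      also have "\<dots> = (\<integral>\<omega>. indicator (X -` A \<inter> space M) \<omega> * real_cond_exp M ?F \<epsilon> \<omega> \<partial>M)"
        using real_cond_exp_intA[OF int A] by (simp add: set_lebesgue_integral_def)
      also have "\<dots> = 0"
        using eps_cond by (intro integral_eq_zero_AE) (auto elim!: eventually_mono)
      finally show ?thesis .
    qed
    define W where "W = 2 * B + 4 * real k * (2 * B + C)"
    define K where "K = 3 * W + 6 * C * W + 8 * W\<^sup>2"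
    \<comment> \<open>Bins of mass at most 1 / m contribute \<open>K / m\<close>, which this choice
      keeps below \<open>1 / (2 * k)\<close>; \<open>m\<close> depends on k also through
      \<open>K\<close>, and n is taken large only afterwards.\<close>
    obtain m :: nat where m: "2 * real k * \<bar>K\<bar> < real m" using reals_Archimedean2 by blast
    moreover have "0 \<le> 2 * real k * \<bar>K\<bar>" by simp
    ultimately have m0: "m > 0" by linarith
    obtain \<beta> where \<beta>: "mono \<beta>" "\<And>t. \<beta> t < m" "\<beta> \<in> borel \<rightarrow>\<^sub>M count_space UNIV"
      and \<delta>: "\<And>j. measure \<mu> {t. \<beta> t = j} \<le> 1 / m"
      by (rule nonatomic_bins[OF mu_prob mu_sets mu_nonatomic m0]) (rule that)
    have risk: "integrable (PiM {..<n} (\<lambda>_. D)) (\<lambda>\<omega>. \<integral>t. (iir_estimator n k \<omega> t - r t)\<^sup>2 \<partial>\<mu>)"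
        "E n k \<le> B\<^sup>2 / (2 * real k) + K * (1 / m + m * (3 + C\<^sup>2) / (2 * sqrt n))" if "n > 0" for n
      unfolding E_def K_def W_def
      by (rule iir_risk_bound[OF mu_prob mu_sets \<beta> \<delta> p q r D_prob D_sets D_fst C_D _ k that], erule centred)+
    have "filterlim (\<lambda>n. 2 * sqrt (real n)) at_top sequentially"
      by (rule filterlim_tendsto_pos_mult_at_top[OF tendsto_const _
        filterlim_compose[OF sqrt_at_top filterlim_real_sequentially]]) simp
    then have "(\<lambda>n. K * (m * (3 + C\<^sup>2) / (2 * sqrt (real n)))) \<longlonglongrightarrow> 0"
      by (intro tendsto_mult_right_zero real_tendsto_divide_at_top[OF tendsto_const])
    then have small: "\<forall>\<^sub>F n in sequentially. K * (m * (3 + C\<^sup>2) / (2 * sqrt (real n))) < 1 / (2 * real k)"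
      by (rule order_tendstoD(2)) (use k in simp)
    have "\<forall>\<^sub>F n in sequentially. E n k \<le> (B\<^sup>2 + 1) / real k"
      using small eventually_gt_at_top[of 0]
    proof eventually_elim
      case (elim n)
      have "E n k \<le> B\<^sup>2 / (2 * real k) + K * (1 / m + m * (3 + C\<^sup>2) / (2 * sqrt n))"
        by (rule risk(2)[OF elim(2)])
      also have "\<dots> = B\<^sup>2 / (2 * real k) + K / m + K * (m * (3 + C\<^sup>2) / (2 * sqrt n))"
        by (simp add: algebra_simps)
      also have "K / m \<le> 1 / (2 * real k)"
      proof -
        have "K * (2 * real k) \<le> \<bar>K\<bar> * (2 * real k)" by (intro mult_right_mono) auto
        then have "K * (2 * real k) \<le> real m" using m by (simp add: algebra_simps)
        then show ?thesis using m0 k by (simp add: field_simps)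
      qed
      also have "B\<^sup>2 / (2 * real k) + 1 / (2 * real k) + K * (m * (3 + C\<^sup>2) / (2 * sqrt n)) \<le>
          B\<^sup>2 / (2 * real k) + 1 / (2 * real k) + 1 / (2 * real k)"
        using elim(1) by linarith
      also have "\<dots> \<le> (B\<^sup>2 + 1) / real k" using k by (simp add: field_simps)
      finally show ?case by simp
    qed
    moreover have "integrable (PiM {..<n} (\<lambda>_. D)) (\<lambda>\<omega>. \<integral>t. (iir_estimator n k \<omega> t - r t)\<^sup>2 \<partial>\<mu>)" for n
    proof (cases "n = 0")
      case False
      then show ?thesis by (intro risk(1)) simp
    qed (simp only: iir_sq_err_integrable_0)
    ultimately show ?thesis by blast
  qed
  have rate: "\<forall>\<^sub>F n in sequentially. E n k \<le> (B\<^sup>2 + 1) / real k" if "k \<ge> 1" for k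
    using main[OF that] by (rule conjunct2)
  obtain \<kappa> where \<kappa>: "mono \<kappa>" "\<And>n. 1 \<le> \<kappa> n" "(\<lambda>n. E n (\<kappa> n)) \<longlonglongrightarrow> 0"
    by (rule diagonal_sequence[of E "B\<^sup>2 + 1"]) (erule rate | rule nonneg | rule that)+
  show ?thesis
    unfolding Let_def f_def[symmetric] D_def[symmetric]
  proof (intro exI[of _ \<kappa>] conjI allI)
    show "integrable (PiM {..<n} (\<lambda>_. D)) (\<lambda>\<omega>. \<integral>x. (iir_estimator n (\<kappa> n) \<omega> x - r x)\<^sup>2 \<partial>\<mu>)" for n
      using main[OF \<kappa>(2)[of n]] by blast
    show "(\<lambda>n. \<integral>\<omega>. (\<integral>x. (iir_estimator n (\<kappa> n) \<omega> x - r x)\<^sup>2 \<partial>\<mu>) \<partial>PiM {..<n} (\<lambda>_. D)) \<longlonglongrightarrow> 0"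
      using \<kappa>(3) unfolding E_def .
  qed (use \<kappa> in auto)
qed

end
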